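(* Let $\mathcal{M}\subset\mathbb{R}^{n\times n}$ be compact, convex and irreducible with $\rho(\mathcal{M})=0$. Let $v$ be the Barabanov norm $v(y)=\sup\left(\limsup_{t\to+\infty}\|x(t)\|\right)$ (supremum over all solutions of the switched system with $x(0)=y$), let $S=\{x:v(x)=1\}$, and let $\Omega$ be the union of the $\omega$-limit sets $\omega(x(\cdot))$ of all extremal trajectories $x(\cdot)$ contained in $S$. Assume that there exists a dense subset $\hat\Omega$ of $\Omega$ such that for every $z_1,z_2\in\hat\Omega$ there exist an integer $N>0$ and extremal trajectories $x_1(\cdot),\dots,x_N(\cdot)$ with $z_1\in\omega(x_1(\cdot))$, $z_2\in\omega(x_N(\cdot))$ and $\omega(x_i(\cdot))\cap\omega(x_{i+1}(\cdot))\neq\emptyset$ for $i=1,\dots,N-1$. Then the Barabanov norm is unique up to homogeneity, i.e. for every Barabanov norm $w(\cdot)$ there exists $\lambda>0$ such that $w(\cdot)=\lambda v(\cdot)$.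
   Context: A switching law is a measurable $A:[0,\infty)\to\mathcal{M}$; a solution (trajectory) of the switched system is an absolutely continuous $x:[0,\infty)\to\mathbb{R}^n$ with $\dot x(t)=A(t)x(t)$ a.e. for some switching law. $\mathcal{M}$ is irreducible if no nonzero proper subspace of $\mathbb{R}^n$ is invariant under all $A\in\mathcal{M}$. $\rho(\mathcal{M}):=\sup\limsup_{t\to+\infty}\frac1t\log\|x(t)\|$, supremum over all solutions with $x(0)\ne0$. $\|\cdot\|$ is the Euclidean norm. A Barabanov norm is a norm $w$ on $\mathbb{R}^n$ such that (1) $w(x(t))\le w(x(0))$ for every solution $x(\cdot)$ and $t\ge0$; (2) for every $y\in\mathbb{R}^n$ there is a solution $x(\cdot)$ with $x(0)=y$ and $w(x(t))=w(y)$ for all $t\ge0$. It is known that, under the stated assumptions on $\mathcal{M}$, the function $v$ in the claim is a Barabanov norm. A solution is extremal (for $v$) if $v(x(t))=v(x(0))$ for all $t\ge0$. $\omega(x(\cdot))$ is the set of $\bar x$ such that $x(t_k)\to\bar x$ for some sequence $t_k\to+\infty$. *)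

theory Defs
  imports "HOL-Analysis.Analysis"
begin

(* The non-overlapping compact subintervals in the epsilon-delta definition of absolute
   continuity are the members of a division; a member {u..v} is nonempty, so its Inf and Sup
   are its endpoints u and v. *)
definition abs_continuous_on :: "real set \<Rightarrow> (real \<Rightarrow> 'a::real_normed_vector) \<Rightarrow> bool" where
  "abs_continuous_on I f \<longleftrightarrow>
     (\<forall>\<epsilon>>0. \<exists>\<delta>>0. \<forall>d T. d division_of T \<and> T \<subseteq> I \<and> (\<Sum>k\<in>d. Sup k - Inf k) < \<delta> \<longrightarrow>
        (\<Sum>k\<in>d. norm (f (Sup k) - f (Inf k))) < \<epsilon>)"

definition switching_law :: "(real ^ 'n ^ 'n) set \<Rightarrow> (real \<Rightarrow> real ^ 'n ^ 'n) \<Rightarrow> bool" where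
  "switching_law M A \<longleftrightarrow> A \<in> borel_measurable (lebesgue_on {0..}) \<and> (\<forall>t\<ge>0. A t \<in> M)"

(* Functions on [0, \<infinity>) are total functions on the reals whose values at negative times are never
   used. Absolute continuity on the unbounded interval [0, \<infinity>) is meant locally, on every [0, T],
   as usual for Caratheodory solutions (exponentially growing solutions are not absolutely
   continuous on the whole half-line). *)
definition trajectory :: "(real ^ 'n ^ 'n) set \<Rightarrow> (real \<Rightarrow> real ^ 'n) \<Rightarrow> bool" where
  "trajectory M x \<longleftrightarrow>
     (\<forall>T\<ge>0. abs_continuous_on {0..T} x) \<and>
     (\<exists>A. switching_law M A \<and>
        (AE t in lebesgue_on {0..}. (x has_vector_derivative A t *v x t) (at t within {0..})))"

definition irreducible_matrices :: "(real ^ 'n ^ 'n) set \<Rightarrow> bool" where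
  "irreducible_matrices M \<longleftrightarrow>
     \<not> (\<exists>V. subspace V \<and> V \<noteq> {0} \<and> V \<noteq> UNIV \<and> (\<forall>A\<in>M. \<forall>y\<in>V. A *v y \<in> V))"

definition lyapunov_exponent :: "(real ^ 'n ^ 'n) set \<Rightarrow> ereal" where
  "lyapunov_exponent M =
     (SUP x \<in> {x. trajectory M x \<and> x 0 \<noteq> 0}. Limsup at_top (\<lambda>t. ereal (1 / t * ln (norm (x t)))))"

definition is_norm :: "('a::real_vector \<Rightarrow> real) \<Rightarrow> bool" where
  "is_norm w \<longleftrightarrow>
     (\<forall>y. 0 \<le> w y) \<and> (\<forall>y. w y = 0 \<longleftrightarrow> y = 0) \<and>
     (\<forall>c y. w (c *\<^sub>R y) = \<bar>c\<bar> * w y) \<and> (\<forall>y z. w (y + z) \<le> w y + w z)"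

definition extremal :: "(real ^ 'n ^ 'n) set \<Rightarrow> (real ^ 'n \<Rightarrow> real) \<Rightarrow> (real \<Rightarrow> real ^ 'n) \<Rightarrow> bool" where
  "extremal M w x \<longleftrightarrow> trajectory M x \<and> (\<forall>t\<ge>0. w (x t) = w (x 0))"

definition barabanov_norm :: "(real ^ 'n ^ 'n) set \<Rightarrow> (real ^ 'n \<Rightarrow> real) \<Rightarrow> bool" where
  "barabanov_norm M w \<longleftrightarrow>
     is_norm w \<and>
     (\<forall>x. trajectory M x \<longrightarrow> (\<forall>t\<ge>0. w (x t) \<le> w (x 0))) \<and>
     (\<forall>y. \<exists>x. trajectory M x \<and> x 0 = y \<and> (\<forall>t\<ge>0. w (x t) = w y))"

(* The supremum is taken in the extended reals; it is finite when M is compact, convex and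
   irreducible with Lyapunov exponent 0, so the conversion to a real then loses nothing. *)
definition limsup_norm :: "(real ^ 'n ^ 'n) set \<Rightarrow> real ^ 'n \<Rightarrow> real" where
  "limsup_norm M y =
     real_of_ereal (SUP x \<in> {x. trajectory M x \<and> x 0 = y}. Limsup at_top (\<lambda>t. ereal (norm (x t))))"

definition omega_limit :: "(real \<Rightarrow> 'a::topological_space) \<Rightarrow> 'a set" where
  "omega_limit x =
     {z. \<exists>s::nat \<Rightarrow> real. filterlim s at_top sequentially \<and> (\<lambda>k. x (s k)) \<longlonglongrightarrow> z}"

definition extremal_limit_set :: "(real ^ 'n ^ 'n) set \<Rightarrow> (real ^ 'n \<Rightarrow> real) \<Rightarrow> (real ^ 'n) set" where
  "extremal_limit_set M w =
     (\<Union>x \<in> {x. extremal M w x \<and> (\<forall>t\<ge>0. x t \<in> {y. w y = 1})}. omega_limit x)"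

end

theory Submission
  imports Defs
begin

text \<open>
  Let \<open>w\<close> be a Barabanov norm. It is nonincreasing along trajectories, hence constant on every
  \<open>\<omega>\<close>-limit set, and the chains force it to be equal to a constant \<open>c\<close> on \<open>\<Omega>\<close>.
  A \<open>v\<close>-extremal trajectory from \<open>y\<close> accumulates in \<open>v y \<cdot> \<Omega>\<close>, so \<open>w y \<ge> c * v y\<close>.
  A limit of time shifts of a \<open>w\<close>-extremal trajectory from \<open>y\<close> is extremal for both norms, takes
  the value \<open>w y\<close> under \<open>w\<close> and a value at most \<open>v y\<close> under \<open>v\<close>; its own \<open>\<omega>\<close>-limit set
  gives \<open>w y \<le> c * v y\<close>.

  The existence of \<open>w\<close> bounds all trajectories, so that \<open>v\<close> is a Barabanov norm by compactness of
  the set of trajectories. For this compactness a switching law is replaced by its primitive: a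
  pointwise limit of such primitives is Lipschitz with difference quotients in \<open>M\<close>, hence
  differentiable almost everywhere with derivative in \<open>M\<close>.
\<close>

section \<open>Absolutely continuous and Lipschitz functions of one variable\<close>

text \<open>The two inequalities are not symmetric. For \<open>c * v y \<le> w y\<close> a
  \<open>v\<close>-extremal trajectory is enough, because \<open>w\<close> can only drop on the way
  to its limit points. A \<open>w\<close>-extremal trajectory keeps \<open>w\<close> but may lose
  \<open>v\<close>, so nothing yet places its limit points in a multiple of \<Omega>; but
  \<open>v\<close> is constant on its limit set, and a trajectory that stays inside this set is
  therefore extremal for both norms. Switching laws themselves are unsuitable for limits: rapidly
  oscillating laws need not have a pointwise limit along any subsequence, while their primitives are
  uniformly Lipschitz. The price is a translation in both directions. Absolute continuity turns the
  almost everywhere equation into an integral equation, which yields inequalities between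
  increments; in the other direction a law has to be recovered by differentiating a Lipschitz
  function almost everywhere. Convexity of \<open>M\<close> puts the difference quotients into
  \<open>M\<close>, and closedness keeps their limits there.\<close>

lemma abs_continuous_on_lipschitz:
  fixes f :: "real \<Rightarrow> 'a::real_normed_vector"
  assumes lip: "\<And>u v. u \<in> {a..b} \<Longrightarrow> v \<in> {a..b} \<Longrightarrow> u \<le> v \<Longrightarrow> norm (f v - f u) \<le> L * (v - u)"
  shows "abs_continuous_on {a..b} f"
  unfolding abs_continuous_on_def
proof (intro allI impI)
  fix e :: real assume "e > 0"
  \<comment> \<open>\<open>L\<close> may be zero or negative, so it cannot serve as a divisor;
    \<open>L'\<close> is positive and still a Lipschitz constant.\<close>
  define L' where "L' = \<bar>L\<bar> + 1"
  have L': "L' > 0" "L \<le> L'" by (auto simp: L'_def)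
  have "(\<Sum>k\<in>d. norm (f (Sup k) - f (Inf k))) < e"
    if d: "d division_of T" "T \<subseteq> {a..b}" and less: "(\<Sum>k\<in>d. Sup k - Inf k) < e / L'" for d T
  proof -
    have "norm (f (Sup k) - f (Inf k)) \<le> L' * (Sup k - Inf k)" if "k \<in> d" for k
    proof -
      obtain u v where k: "k = {u..v}"
        using division_ofD(4)[OF d(1) \<open>k \<in> d\<close>] by auto
      have "k \<noteq> {}" "k \<subseteq> T" using division_ofD(2,3)[OF d(1) \<open>k \<in> d\<close>] by auto
      with k have "u \<le> v" by simp
      have "{u..v} \<subseteq> {a..b}" using order_trans[OF \<open>k \<subseteq> T\<close> d(2)] k by simp
      then have "u \<in> {a..b}" "v \<in> {a..b}" using \<open>u \<le> v\<close> by simp_all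
      with lip[of u v] have "norm (f v - f u) \<le> L' * (v - u)"
        using L'(2) \<open>u \<le> v\<close> mult_right_mono[of L L' "v - u"] by linarith
      with k \<open>u \<le> v\<close> show ?thesis by simp
    qed
    then have "(\<Sum>k\<in>d. norm (f (Sup k) - f (Inf k))) \<le> L' * (\<Sum>k\<in>d. Sup k - Inf k)"
      by (simp add: sum_distrib_left sum_mono)
    also have "\<dots> < e"
      using less L' by (simp add: field_simps)
    finally show ?thesis .
  qed
  then show "\<exists>\<delta>>0. \<forall>d T. d division_of T \<and> T \<subseteq> {a..b} \<and> (\<Sum>k\<in>d. Sup k - Inf k) < \<delta> \<longrightarrow>
        (\<Sum>k\<in>d. norm (f (Sup k) - f (Inf k))) < e"
    using \<open>e > 0\<close> L' by (intro exI[of _ "e / L'"]) auto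
qed

section \<open>The fundamental theorem of calculus for absolutely continuous functions\<close>

lemma division_sum_le_measure:
  fixes U :: "real set"
  assumes d: "d division_of T" and "T \<subseteq> U" "U \<in> lmeasurable"
  shows "(\<Sum>k\<in>d. Sup k - Inf k) \<le> measure lebesgue U"
proof -
  have "(\<Sum>k\<in>d. Sup k - Inf k) = (\<Sum>k\<in>d. measure lebesgue k)"
  proof (rule sum.cong)
    fix k assume "k \<in> d"
    obtain u v where k: "k = {u..v}"
      using division_ofD(4)[OF d \<open>k \<in> d\<close>] by auto
    have "k \<noteq> {}" using division_ofD(3)[OF d \<open>k \<in> d\<close>] by auto
    with k show "Sup k - Inf k = measure lebesgue k" by auto
  qed simp
  also have "\<dots> = measure lebesgue T"
    using content_division[OF d] by simp
  also have "\<dots> \<le> measure lebesgue U"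
    using assms lmeasurable_division[OF d] by (intro measure_mono_fmeasurable) auto
  finally show ?thesis .
qed

text \<open>Gauge argument: near the exceptional set the gauge stays inside an open set of small measure,
  where absolute continuity makes the increments of \<open>f\<close> negligible.\<close>

theorem fundamental_theorem_abs_continuous:
  fixes f :: "real \<Rightarrow> 'a::banach"
  assumes "a \<le> b" and ac: "abs_continuous_on {a..b} f" and E: "negligible E"
    and der: "\<And>t. t \<in> {a..b} - E \<Longrightarrow> (f has_vector_derivative g t) (at t within {a..b})"
  shows "(g has_integral (f b - f a)) {a..b}"
proof (rule has_integral_spike[OF E])
  \<comment> \<open>With the value 0 on \<open>E\<close>, a Riemann sum term tagged in
    \<open>E\<close> leaves only the increment of \<open>f\<close>, which absolute continuity
    controls.\<close>
  define h where "h t = (if t \<in> E then 0 else g t)" for t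
  show "g x = h x" if "x \<in> {a..b} - E" for x using that by (simp add: h_def)
  show "(h has_integral (f b - f a)) {a..b}"
  proof (cases "a = b")
    case True
    then show ?thesis by (simp add: has_integral_refl)
  next
    case False
    with \<open>a \<le> b\<close> have "a < b" by simp
    show ?thesis
      unfolding has_integral_factor_content_real
    proof (intro allI impI)
      fix e :: real assume "e > 0"
      \<comment> \<open>The tolerance \<open>e * (b - a)\<close> is halved: one half for the tags
        outside \<open>E\<close>, where \<open>f\<close> is differentiable, the other for the tags
        in \<open>E\<close>.\<close>
      define e1 where "e1 = e * (b - a) / 2"
      have "e1 > 0" using \<open>e > 0\<close> \<open>a < b\<close> by (simp add: e1_def)
      then obtain \<delta> where "\<delta> > 0"
        and \<delta>: "\<And>d T. d division_of T \<Longrightarrow> T \<subseteq> {a..b} \<Longrightarrow> (\<Sum>k\<in>d. Sup k - Inf k) < \<delta> \<Longrightarrow>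
          (\<Sum>k\<in>d. norm (f (Sup k) - f (Inf k))) < e1"
        using ac unfolding abs_continuous_on_def by meson
      have "E \<in> sets lebesgue" using E by (simp add: negligible_imp_sets)
      then obtain U where U: "open U" "E \<subseteq> U" "U - E \<in> lmeasurable" "emeasure lebesgue (U - E) < ennreal \<delta>"
        using sets_lebesgue_outer_open \<open>\<delta> > 0\<close> by blast
      have UE: "U = (U - E) \<union> E" using U(2) by auto
      have Um: "U \<in> lmeasurable"
        using U(3) E by (metis UE fmeasurable.Un negligible_imp_measurable)
      have "measure lebesgue U = measure lebesgue (U - E)"
        using E by (metis UE measure_Un_null_set U(3) fmeasurableD negligible_iff_null_sets)
      moreover have "measure lebesgue (U - E) < \<delta>"
        using U(3,4) \<open>\<delta> > 0\<close> by (simp add: emeasure_eq_measure2 ennreal_less_iff)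
      ultimately have Ud: "measure lebesgue U < \<delta>" by simp
      have "\<exists>r>0. \<forall>y\<in>{a..b}. \<bar>y - t\<bar> < r \<longrightarrow> norm (f y - f t - (y - t) *\<^sub>R g t) \<le> (e/2) * \<bar>y - t\<bar>"
        if "t \<in> {a..b} - E" for t
        using der[OF that] \<open>e > 0\<close> unfolding has_vector_derivative_def has_derivative_within_alt real_norm_def
        by (meson half_gt_zero)
      then obtain r where r: "\<And>t. t \<in> {a..b} - E \<Longrightarrow> r t > 0"
        "\<And>t y. t \<in> {a..b} - E \<Longrightarrow> y \<in> {a..b} \<Longrightarrow> \<bar>y - t\<bar> < r t \<Longrightarrow>
            norm (f y - f t - (y - t) *\<^sub>R g t) \<le> (e/2) * \<bar>y - t\<bar>"
        by metis
      \<comment> \<open>Around a tag in \<open>E\<close> the gauge set is all of \<open>U\<close>,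
        so every interval tagged there lies in \<open>U\<close>. The last case never meets a tag,
        since all tags lie in \<open>{a..b}\<close>.\<close>
      define D where "D t = (if t \<in> E then U else if t \<in> {a..b} then ball t (r t) else ball t 1)" for t
      have "gauge D"
        unfolding gauge_def D_def using U r(1) by auto
      have "norm ((\<Sum>(t, k :: real set)\<in>p. measure lborel k *\<^sub>R h t) - (f b - f a)) \<le> e * measure lborel {a..b}"
        if p: "p tagged_division_of {a..b}" and fine: "D fine p" for p
      proof -
        have fin: "finite p" using p by blast
        define F where "F = (\<lambda>(t::real, k::real set). f (Sup k) - f (Inf k))"
        define H where "H = (\<lambda>(t, k :: real set). measure lborel k *\<^sub>R h t)"
        define P where "P = {q \<in> p. fst q \<in> E}"
        have pP: "P \<subseteq> p" by (auto simp: P_def)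
        have kform: "\<exists>u v. k = {u..v} \<and> u \<le> t \<and> t \<le> v \<and> a \<le> u \<and> v \<le> b" if tk: "(t, k) \<in> p" for t k
        proof -
          obtain u v where k: "k = {u..v}"
            using tagged_division_ofD(4)[OF p tk] by auto
          moreover have "t \<in> k" "k \<subseteq> {a..b}" using tagged_division_ofD(2,3)[OF p tk] by auto
          ultimately show ?thesis by auto
        qed
        have "f b - f a = sum F p"
          using additive_tagged_division_1[OF \<open>a \<le> b\<close> p, of f] by (simp add: F_def)
        then have "(\<Sum>(t, k :: real set)\<in>p. measure lborel k *\<^sub>R h t) - (f b - f a) = (\<Sum>q\<in>p. H q - F q)"
          by (simp add: H_def sum_subtractf)
        also have "\<dots> = (\<Sum>q\<in>p - P. H q - F q) + (\<Sum>q\<in>P. H q - F q)"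
          using fin pP by (simp add: sum.subset_diff)
        also have "norm \<dots> \<le> norm (\<Sum>q\<in>p - P. H q - F q) + norm (\<Sum>q\<in>P. H q - F q)"
          by (rule norm_triangle_ineq)
        also have "norm (\<Sum>q\<in>p - P. H q - F q) \<le> (\<Sum>q\<in>p - P. (e/2) * measure lborel (snd q))"
        proof (rule sum_norm_le)
          fix q assume q: "q \<in> p - P"
          obtain t k where qk: "q = (t, k)" by (cases q)
          with q have tk: "(t, k) \<in> p" "t \<notin> E" by (auto simp: P_def)
          then obtain u v where k: "k = {u..v}" "u \<le> t" "t \<le> v" "a \<le> u" "v \<le> b" using kform by blast
          then have t: "t \<in> {a..b} - E" using tk by auto
          have "k \<subseteq> ball t (r t)"
            using fine tk t unfolding fine_def D_def by fastforce
          then have "u \<in> ball t (r t)" "v \<in> ball t (r t)"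
            using k subsetD[of k "ball t (r t)" u] subsetD[of k "ball t (r t)" v] by simp_all
          then have uv: "\<bar>u - t\<bar> < r t" "\<bar>v - t\<bar> < r t" by (auto simp: dist_real_def)
          have 1: "norm (f u - f t - (u - t) *\<^sub>R g t) \<le> (e/2) * (t - u)"
            using r(2)[OF t, of u] uv k by auto
          have 2: "norm (f v - f t - (v - t) *\<^sub>R g t) \<le> (e/2) * (v - t)"
            using r(2)[OF t, of v] uv k by auto
          \<comment> \<open>The tag lies between the endpoints, so the two one-sided error bounds,
            proportional to \<open>t - u\<close> and \<open>v - t\<close>, add up to a multiple of
            the length of the interval.\<close>
          have "H q - F q = (f u - f t - (u - t) *\<^sub>R g t) - (f v - f t - (v - t) *\<^sub>R g t)"
            using k tk by (simp add: H_def F_def qk h_def algebra_simps)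
          also have "norm \<dots> \<le> (e/2) * (t - u) + (e/2) * (v - t)"
            using norm_triangle_ineq4 1 2 by (meson add_mono order_trans)
          also have "\<dots> = (e/2) * (v - u)"
            unfolding distrib_left[symmetric] by simp
          also have "\<dots> = (e/2) * measure lborel (snd q)"
            using k by (simp add: qk)
          finally show "norm (H q - F q) \<le> (e/2) * measure lborel (snd q)" .
        qed
        also have "\<dots> \<le> (\<Sum>q\<in>p. (e/2) * measure lborel (snd q))"
          using fin \<open>e > 0\<close> by (intro sum_mono2) auto
        also have "\<dots> = (e/2) * (b - a)"
          using additive_content_tagged_division[of p a b] p \<open>a < b\<close>
          unfolding sum_distrib_left[symmetric] by (simp add: case_prod_unfold)
        also have "norm (\<Sum>q\<in>P. H q - F q) \<le> e1"
        proof -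
          have Ppart: "P tagged_partial_division_of {a..b}"
            using p pP by (meson tagged_division_of_def tagged_partial_division_subset)
          have div: "(snd ` P) division_of \<Union>(snd ` P)"
            by (rule partial_division_of_tagged_division[OF Ppart])
          have "\<Union>(snd ` P) \<subseteq> U"
            using fine unfolding P_def fine_def D_def by fastforce
          then have "(\<Sum>k\<in>snd ` P. Sup k - Inf k) < \<delta>"
            using division_sum_le_measure[OF div _ Um] Ud by linarith
          moreover have "\<Union>(snd ` P) \<subseteq> {a..b}"
            using p pP by (fastforce dest: tagged_division_ofD(3))
          ultimately have "(\<Sum>k\<in>snd ` P. norm (f (Sup k) - f (Inf k))) < e1"
            using \<delta>[OF div] by blast
          \<comment> \<open>To pass from intervals to tagged intervals, the summand has to vanish on
            every box with empty interior. For the empty box \<open>Sup\<close> and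
            \<open>Inf\<close> give no such guarantee, hence the conditional.\<close>
          also have "(\<Sum>k\<in>snd ` P. norm (f (Sup k) - f (Inf k)))
              = (\<Sum>k\<in>snd ` P. if k = {} then 0 else norm (f (Sup k) - f (Inf k)))"
            by (rule sum.cong) (use division_ofD(3)[OF div] in simp_all)
          also have "\<dots> = (\<Sum>(t, k)\<in>P. if k = {} then 0 else norm (f (Sup k) - f (Inf k)))"
          proof (rule sum.over_tagged_division_lemma[OF tagged_partial_division_of_Union_self[OF Ppart], symmetric])
            fix u v :: real assume "box u v = {}"
            then show "(if cbox u v = {} then 0 else norm (f (Sup (cbox u v)) - f (Inf (cbox u v)))) = 0"
              by (cases "u = v") auto
          qed
          also have "\<dots> = (\<Sum>(t, k)\<in>P. norm (f (Sup k) - f (Inf k)))"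
          proof (rule sum.cong)
            fix q assume "q \<in> P"
            then have "snd q \<noteq> {}" using division_ofD(3)[OF div] by blast
            then show "(case q of (t, k) \<Rightarrow> if k = {} then 0 else norm (f (Sup k) - f (Inf k)))
                = (case q of (t, k) \<Rightarrow> norm (f (Sup k) - f (Inf k)))"
              by (simp add: case_prod_unfold)
          qed simp
          finally have "(\<Sum>(t, k)\<in>P. norm (f (Sup k) - f (Inf k))) < e1" .
          moreover have "norm (\<Sum>q\<in>P. H q - F q) \<le> (\<Sum>(t, k)\<in>P. norm (f (Sup k) - f (Inf k)))"
            by (rule sum_norm_le) (auto simp: P_def H_def F_def h_def norm_minus_commute)
          ultimately show ?thesis by linarith
        qed
        also have "e/2 * (b - a) + e1 = e * measure lborel {a..b}"
          using \<open>a < b\<close> by (simp add: e1_def field_simps)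
        finally show ?thesis by simp
      qed
      then show "\<exists>d. gauge d \<and> (\<forall>p. p tagged_division_of {a..b} \<and> d fine p \<longrightarrow>
          norm ((\<Sum>(x, k)\<in>p. measure lborel k *\<^sub>R h x) - (f b - f a)) \<le> e * measure lborel {a..b})"
        by (intro exI[of _ D] conjI allI impI \<open>gauge D\<close>) blast
    qed
  qed
qed

section \<open>Almost everywhere differentiability of indefinite integrals and of Lipschitz
  functions\<close>

lemma indefinite_integral_has_vector_derivative_AE:
  fixes F g :: "real \<Rightarrow> 'a::euclidean_space"
  assumes int: "\<And>a b. a \<le> b \<Longrightarrow> (g has_integral (F b - F a)) {a..b}"
  shows "negligible {x. \<not> (F has_vector_derivative g x) (at x)}"
proof -
  have int1: "g integrable_on cbox a b" for a b
    using int[of a b] by (cases "a \<le> b") (auto intro: has_integral_integrable)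
  \<comment> \<open>Averages of \<open>g\<close> over \<open>{x..x + h}\<close> give right
    derivatives only. Left derivatives at \<open>x\<close> come from the right averages of the
    reflected function at \<open>- x\<close>.\<close>
  have int2: "(\<lambda>x. g (- x)) integrable_on cbox a b" for a b
    using int1[of "-b" "-a"] Henstock_Kurzweil_Integration.integrable_reflect_real[where f=g and a="-b" and b="-a"] by simp
  obtain N1 where N1: "negligible N1" "\<And>x e. x \<notin> N1 \<Longrightarrow> 0 < e \<Longrightarrow>
      \<exists>d>0. \<forall>h. 0 < h \<and> h < d \<longrightarrow> norm (integral {x..x + h} g /\<^sub>R h - g x) < e"
    using integrable_ccontinuous_explicit[OF int1] by (simp add: mult.commute) metis
  obtain N2 where N2: "negligible N2" "\<And>x e. x \<notin> N2 \<Longrightarrow> 0 < e \<Longrightarrow>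
      \<exists>d>0. \<forall>h. 0 < h \<and> h < d \<longrightarrow> norm (integral {x..x + h} (\<lambda>x. g (- x)) /\<^sub>R h - g (- x)) < e"
    using integrable_ccontinuous_explicit[OF int2] by (simp add: mult.commute) metis
  have "(F has_vector_derivative g x) (at x)" if x: "x \<notin> N1" "- x \<notin> N2" for x
    unfolding has_vector_derivative_def has_derivative_at_alt
  proof (intro conjI allI impI bounded_linear_scaleR_left)
    fix e :: real assume "e > 0"
    obtain d1 where d1: "d1 > 0" "\<And>h. 0 < h \<Longrightarrow> h < d1 \<Longrightarrow> norm (integral {x..x + h} g /\<^sub>R h - g x) < e"
      using N1(2)[OF x(1) \<open>e > 0\<close>] by blast
    obtain d2 where d2: "d2 > 0"
      "\<And>h. 0 < h \<Longrightarrow> h < d2 \<Longrightarrow> norm (integral {- x..- x + h} (\<lambda>x. g (- x)) /\<^sub>R h - g x) < e"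
      using N2(2)[OF x(2) \<open>e > 0\<close>] by auto
    have conv: "norm (w - h *\<^sub>R z) \<le> e * h" if "norm (w /\<^sub>R h - z) < e" "h > 0" for w z :: 'a and h
    proof -
      have "w - h *\<^sub>R z = h *\<^sub>R (w /\<^sub>R h - z)"
        using \<open>h > 0\<close> by (simp add: algebra_simps)
      then have "norm (w - h *\<^sub>R z) = h * norm (w /\<^sub>R h - z)"
        using \<open>h > 0\<close> by simp
      also have "\<dots> \<le> h * e" using that by (intro mult_left_mono) auto
      finally show ?thesis by (simp add: mult.commute)
    qed
    have "norm (F y - F x - (y - x) *\<^sub>R g x) \<le> e * norm (y - x)" if y: "norm (y - x) < min d1 d2" for y
    proof (cases y x rule: linorder_cases)
      case equal
      then show ?thesis by simp
    next
      case greater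
      then have "integral {x..x + (y - x)} g = F y - F x"
        using int[of x y] by (simp add: integral_unique)
      with conv[where w="F y - F x" and h="y - x" and z="g x"] d1(2)[of "y - x"] greater y show ?thesis by simp
    next
      case less
      have "integral {- x..- x + (x - y)} (\<lambda>x. g (- x)) = integral {y..x} g"
        using Henstock_Kurzweil_Integration.integral_reflect_real[where f=g and a=y and b=x] by simp
      also have "\<dots> = F x - F y"
        using int[of y x] less by (simp add: integral_unique)
      finally have "norm ((F x - F y) - (x - y) *\<^sub>R g x) \<le> e * (x - y)"
        using conv[where w="F x - F y" and h="x - y" and z="g x"] d2(2)[of "x - y"] less y by simp
      moreover have "F y - F x - (y - x) *\<^sub>R g x = - ((F x - F y) - (x - y) *\<^sub>R g x)"
        by (simp add: algebra_simps)
      ultimately show ?thesis using less by (metis abs_minus_commute abs_of_pos diff_gt_0_iff_gt norm_minus_cancel real_norm_def)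
    qed
    then show "\<exists>d>0. \<forall>y. norm (y - x) < d \<longrightarrow> norm (F y - F x - (y - x) *\<^sub>R g x) \<le> e * norm (y - x)"
      using d1(1) d2(1) by (intro exI[of _ "min d1 d2"]) auto
  qed
  then have "{x. \<not> (F has_vector_derivative g x) (at x)} \<subseteq> N1 \<union> uminus ` N2"
    by (auto simp: image_iff) (metis minus_minus)
  moreover have "negligible (uminus ` N2)"
    by (rule negligible_differentiable_image_negligible[OF _ N2(1)]) (auto intro: derivative_intros)
  then have "negligible (N1 \<union> uminus ` N2)"
    using N1(1) by simp
  ultimately show ?thesis by (rule negligible_subset[rotated])
qed

text \<open>After adding a linear term \<open>f\<close> becomes a homeomorphism \<open>F\<close> whose Stieltjes measure is the image of
  Lebesgue measure under the inverse of \<open>F\<close>; Lipschitz images of null sets being null, it has a density.\<close>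

lemma real_lipschitz_differentiable_AE:
  fixes f :: "real \<Rightarrow> real"
  assumes lip: "\<And>u v. \<bar>f v - f u\<bar> \<le> L * \<bar>v - u\<bar>"
  shows "negligible {x. \<not> f differentiable (at x)}"
proof -
  have "L \<ge> 0" using lip[of 1 0] by simp
  \<comment> \<open>The slope \<open>L + 1\<close> outweighs the Lipschitz constant, so the
    increments of \<open>F\<close> lie between \<open>v - u\<close> and
    \<open>(2 * L + 1) * (v - u)\<close>: \<open>F\<close> is an increasing bi-Lipschitz map of the
    line onto itself.\<close>
  define F where "F t = f t + (L + 1) * t" for t
  have lo: "v - u \<le> F v - F u" if "u \<le> v" for u v
    using lip[of v u] that by (simp add: F_def algebra_simps abs_le_iff)
  have up: "F v - F u \<le> (2 * L + 1) * (v - u)" if "u \<le> v" for u v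
    using lip[of v u] that by (simp add: F_def algebra_simps abs_le_iff)
  have lo': "\<bar>v - u\<bar> \<le> \<bar>F v - F u\<bar>" for u v
    using lo[of u v] lo[of v u] by linarith
  have up': "\<bar>F v - F u\<bar> \<le> (2 * L + 1) * \<bar>v - u\<bar>" for u v
    using up[of u v] up[of v u] lo[of u v] lo[of v u] by (cases "u \<le> v") auto
  have contF: "continuous_on UNIV F"
    by (rule lipschitz_on_continuous_on[of "2 * L + 1"])
      (use up' \<open>L \<ge> 0\<close> in \<open>auto simp: lipschitz_on_def dist_real_def\<close>)
  have "inj F" using lo' by (intro injI) (metis abs_le_zero_iff abs_zero eq_iff_diff_eq_0)
  have "surj F"
  proof -
    have "\<exists>x. F x = y" for y
    proof -
      define s where "s = \<bar>y\<bar> + \<bar>F 0\<bar>"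
      have "F (-s) \<le> y" "y \<le> F s" using lo[of "-s" 0] lo[of 0 s] unfolding s_def by linarith+
      then show ?thesis
        using IVT'[of F "-s" y s] continuous_on_subset[OF contF] by (auto simp: s_def)
    qed
    then show ?thesis by (metis surjI)
  qed
  define G where "G = inv F"
  have FG: "F (G y) = y" and GF: "G (F x) = x" for x y
    using \<open>inj F\<close> \<open>surj F\<close> by (simp_all add: G_def surj_f_inv_f)
  have contG: "continuous_on UNIV G"
  proof (rule lipschitz_on_continuous_on[of 1])
    show "1-lipschitz_on UNIV G"
      using lo'[of "G _" "G _"] by (simp add: FG lipschitz_on_def dist_real_def)
  qed
  then have Gm [measurable]: "G \<in> borel_measurable borel"
    by (rule borel_measurable_continuous_onI)
  \<comment> \<open>\<open>\<mu>\<close> assigns to a Borel set the Lebesgue measure of its image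
    under \<open>F\<close>; its density will turn out to be the derivative of \<open>F\<close>
    almost everywhere.\<close>
  define \<mu> where "\<mu> = distr lborel borel G"
  have em: "emeasure \<mu> A = emeasure lborel (F ` A)" if "A \<in> sets borel" for A
  proof -
    have "G -` A = F ` A" using FG GF by (auto simp: image_iff) metis
    then show ?thesis using that by (simp add: \<mu>_def emeasure_distr)
  qed
  have emI: "emeasure \<mu> {a..b} = ennreal (F b - F a)" if ab: "a \<le> b" for a b
  proof -
    have "F ` {a..b} = {F a..F b}"
    proof (intro equalityI subsetI)
      fix y assume "y \<in> {F a..F b}"
      then obtain x where "a \<le> x" "x \<le> b" "F x = y"
        using IVT'[of F a y b] ab continuous_on_subset[OF contF subset_UNIV] by (metis atLeastAtMost_iff)
      then show "y \<in> F ` {a..b}" by auto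
    next
      fix y assume "y \<in> F ` {a..b}"
      then show "y \<in> {F a..F b}" using lo by fastforce
    qed
    moreover have "F a \<le> F b" using lo[OF ab] ab by simp
    ultimately show ?thesis by (simp add: em)
  qed
  have "absolutely_continuous lborel \<mu>"
    unfolding absolutely_continuous_def
  proof
    fix N :: "real set" assume N: "N \<in> null_sets lborel"
    then have Nb: "N \<in> sets borel" by (auto dest: null_setsD2)
    have "negligible N"
      using N by (simp add: negligible_iff_null_sets null_sets_completionI)
    have neg: "negligible (F ` N)"
    proof (rule negligible_locally_Lipschitz_image[OF _ \<open>negligible N\<close>])
      show "\<exists>T B. open T \<and> x \<in> T \<and> (\<forall>y\<in>N \<inter> T. norm (F y - F x) \<le> B * norm (y - x))" for x
        using up' by (intro exI[of _ UNIV] exI[of _ "2 * L + 1"]) auto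
    qed simp
    have "G -` N = F ` N" using FG GF by (auto simp: image_iff) metis
    then have "F ` N \<in> sets borel" using measurable_sets_borel[OF Gm Nb] by simp
    then have "F ` N \<in> null_sets lborel"
      using neg null_sets_completion_iff[of "F ` N" lborel] by (simp add: negligible_iff_null_sets)
    then show "N \<in> null_sets \<mu>" using em[OF Nb] Nb by (auto simp: null_sets_def \<mu>_def)
  qed
  moreover have "sets \<mu> = sets lborel" by (simp add: \<mu>_def)
  ultimately obtain \<rho> where \<rho>[measurable]: "\<rho> \<in> borel_measurable lborel" and dens: "density lborel \<rho> = \<mu>"
    using sigma_finite_measure.Radon_Nikodym[OF sigma_finite_lborel] by blast
  have nn: "(\<integral>\<^sup>+x. \<rho> x * indicator {a..b} x \<partial>lborel) = ennreal (F b - F a)" if "a \<le> b" for a b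
    using emI[OF that] emeasure_density[OF \<rho>, of "{a..b}"] by (simp add: dens)
  \<comment> \<open>A Radon-Nikodym density may be infinite. Its finite integrals over
    \<open>{- real n..real n}\<close> confine this to a null set, so that \<open>enn2real\<close>
    loses nothing almost everywhere.\<close>
  have "AE x in lborel. \<rho> x * indicator {- real n..real n} x \<noteq> \<infinity>" for n
    by (rule nn_integral_PInf_AE) (auto simp: nn)
  then have "AE x in lborel. \<forall>n. \<rho> x * indicator {- real n..real n} x \<noteq> \<infinity>"
    by (simp add: AE_all_countable)
  then have fin: "AE x in lborel. \<rho> x \<noteq> \<infinity>"
  proof eventually_elim
    case (elim x)
    obtain n :: nat where "\<bar>x\<bar> \<le> real n" using real_arch_simple by blast
    then have "x \<in> {- real n..real n}" by auto
    then show ?case using spec[OF elim, of n] by simp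
  qed
  define g where "g x = enn2real (\<rho> x)" for x
  have "(g has_integral (F b - F a)) {a..b}" if "a \<le> b" for a b
  proof -
    have "(\<integral>\<^sup>+x. ennreal (g x * indicator {a..b} x) \<partial>lborel) = (\<integral>\<^sup>+x. \<rho> x * indicator {a..b} x \<partial>lborel)"
    proof (rule nn_integral_cong_AE)
      show "AE x in lborel. ennreal (g x * indicator {a..b} x) = \<rho> x * indicator {a..b} x"
        using fin by eventually_elim (simp add: g_def indicator_def less_top)
    qed
    also have "\<dots> = ennreal (F b - F a)" by (rule nn[OF that])
    finally have "((\<lambda>x. g x * indicator {a..b} x) has_integral (F b - F a)) UNIV"
      using lo[OF that] that by (intro nn_integral_has_integral) (auto simp: g_def)
    moreover have "(\<lambda>x. g x * indicator {a..b} x) = (\<lambda>x. if x \<in> {a..b} then g x else 0)"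
      by (auto simp: indicator_def)
    ultimately show ?thesis by (simp only: has_integral_restrict_UNIV)
  qed
  then have "negligible {x. \<not> (F has_vector_derivative g x) (at x)}"
    by (rule indefinite_integral_has_vector_derivative_AE)
  moreover have "f differentiable (at x)" if "(F has_vector_derivative g x) (at x)" for x
  proof -
    have "F differentiable (at x)" using that by (auto simp: has_vector_derivative_def differentiable_def)
    then have "(\<lambda>t. F t - (L + 1) * t) differentiable (at x)"
      by (intro differentiable_diff differentiable_mult differentiable_const differentiable_ident)
    then show ?thesis by (simp add: F_def)
  qed
  then have "{x. \<not> f differentiable (at x)} \<subseteq> {x. \<not> (F has_vector_derivative g x) (at x)}"
    by blast
  ultimately show ?thesis by (rule negligible_subset)
qed

lemma lipschitz_differentiable_AE:
  fixes f :: "real \<Rightarrow> 'a::euclidean_space"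
  assumes lip: "\<And>u v. norm (f v - f u) \<le> L * \<bar>v - u\<bar>"
  shows "negligible {x. \<not> f differentiable (at x)}"
proof -
  have "negligible {x. \<not> (\<lambda>x. f x \<bullet> i) differentiable (at x)}" if "i \<in> Basis" for i
  proof (rule real_lipschitz_differentiable_AE)
    show "\<bar>f v \<bullet> i - f u \<bullet> i\<bar> \<le> L * \<bar>v - u\<bar>" for u v
      using Basis_le_norm[OF that, of "f v - f u"] lip[of v u] by (simp add: inner_diff_left)
  qed
  then have "negligible (\<Union>i\<in>Basis. {x. \<not> (\<lambda>x. f x \<bullet> i) differentiable (at x)})"
    by (intro negligible_Union) auto
  moreover have "{x. \<not> f differentiable (at x)} \<subseteq> (\<Union>i\<in>Basis. {x. \<not> (\<lambda>x. f x \<bullet> i) differentiable (at x)})"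
    using differentiable_componentwise_within[of f _ UNIV] by auto
  ultimately show ?thesis by (rule negligible_subset)
qed

section \<open>Trajectories through difference quotients\<close>

lemma bounded_bilinear_matrix_vector_mult:
  "bounded_bilinear ((*v) :: real^'n^'m \<Rightarrow> real^'n \<Rightarrow> real^'m)"
  unfolding bilinear_conv_bounded_bilinear[symmetric] bilinear_def
  by (auto intro!: linearI simp: matrix_vector_mult_add_rdistrib matrix_vector_right_distrib
      scaleR_matrix_vector_assoc[symmetric] matrix_vector_mult_scaleR)

text \<open>\<open>norm\<close> on matrices is the Euclidean norm and not the operator norm, so the
  two estimates come with the constants \<open>b\<close> and \<open>b * K\<close>; their sum serves
  for both.\<close>

lemma bounded_matrices_uniform_bound:
  fixes M :: "(real^'n^'n) set"
  assumes "bounded M"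
  obtains C where "C > 0" "\<And>A. A \<in> M \<Longrightarrow> norm A \<le> C" "\<And>A y. A \<in> M \<Longrightarrow> norm (A *v y) \<le> C * norm y"
proof -
  obtain K where "K > 0" and K: "\<And>(A :: real^'n^'n) y. norm (A *v y) \<le> norm A * norm y * K"
    using bounded_bilinear.pos_bounded[OF bounded_bilinear_matrix_vector_mult] by metis
  obtain b where "b > 0" and b: "\<And>A. A \<in> M \<Longrightarrow> norm A \<le> b"
    using assms bounded_pos by metis
  show thesis
  proof (rule that[of "b + b * K"])
    show "b + b * K > 0" using \<open>K > 0\<close> \<open>b > 0\<close> by (simp add: add_pos_pos)
    fix A assume A: "A \<in> M"
    have "0 \<le> b * K" using \<open>K > 0\<close> \<open>b > 0\<close> by simp
    with b[OF A] show "norm A \<le> b + b * K" by linarith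
    fix y :: "real^'n"
    have "norm (A *v y) \<le> norm A * norm y * K" by (rule K)
    also have "\<dots> \<le> b * norm y * K" using b[OF A] \<open>K > 0\<close> by (intro mult_right_mono) auto
    also have "\<dots> \<le> (b + b * K) * norm y" using \<open>b > 0\<close> by (simp add: algebra_simps)
    finally show "norm (A *v y) \<le> (b + b * K) * norm y" .
  qed
qed

text \<open>The Caratheodory integral equation for one fixed \<open>A\<close>. With the law as a
  parameter the equation is linear in \<open>x\<close>, which is what makes superposition
  available.\<close>

definition solves :: "(real \<Rightarrow> real^'n^'n) \<Rightarrow> (real \<Rightarrow> real^'n) \<Rightarrow> bool" where
  "solves A x \<longleftrightarrow> (\<forall>u v. 0 \<le> u \<and> u \<le> v \<longrightarrow> ((\<lambda>s. A s *v x s) has_integral (x v - x u)) {u..v})"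

text \<open>The difference quotients of a primitive of a law in \<open>M\<close> lie in \<open>M\<close>. Together with
  \<open>driven\<close>, a first-order condition on \<open>x\<close> with a quadratic error, this describes trajectories by
  conditions that survive pointwise limits.\<close>

definition law_primitive :: "(real^'n^'n) set \<Rightarrow> (real \<Rightarrow> real^'n^'n) \<Rightarrow> bool" where
  "law_primitive M B \<longleftrightarrow> (\<forall>u v. 0 \<le> u \<and> u < v \<longrightarrow> (1 / (v - u)) *\<^sub>R (B v - B u) \<in> M)"

definition driven :: "(real \<Rightarrow> real^'n^'n) \<Rightarrow> real \<Rightarrow> real \<Rightarrow> (real \<Rightarrow> real^'n) \<Rightarrow> bool" where
  "driven B K T x \<longleftrightarrow>
     (\<forall>u v. 0 \<le> u \<and> u \<le> v \<and> v \<le> T \<longrightarrow> norm (x v - x u - (B v - B u) *v x u) \<le> K * (v - u)\<^sup>2)"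

section \<open>From the differential equation to inequalities between increments\<close>

lemma trajectory_imp_solves:
  assumes "trajectory M x"
  obtains A where "switching_law M A" "solves A x"
proof -
  obtain A where A: "switching_law M A"
    and ae: "AE t in lebesgue_on {0..}. (x has_vector_derivative A t *v x t) (at t within {0..})"
    using assms unfolding trajectory_def by blast
  have "AE t in lebesgue. t \<in> {0..} \<longrightarrow> (x has_vector_derivative A t *v x t) (at t within {0..})"
    using ae by (simp add: AE_restrict_space_iff)
  then obtain E where E: "negligible E"
    "\<And>t. t \<notin> E \<Longrightarrow> t \<ge> 0 \<Longrightarrow> (x has_vector_derivative A t *v x t) (at t within {0..})"
    unfolding eventually_ae_filter_negligible by (auto simp: subset_iff)
  have "solves A x"
    unfolding solves_def
  proof (intro allI impI)
    fix u v :: real assume uv: "0 \<le> u \<and> u \<le> v"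
    show "((\<lambda>s. A s *v x s) has_integral (x v - x u)) {u..v}"
    \<comment> \<open>A derivative almost everywhere would not by itself determine the increments of
      \<open>x\<close>; together with the local absolute continuity in \<open>trajectory\<close> it
      does.\<close>
    proof (rule fundamental_theorem_abs_continuous[OF _ _ E(1)])
      have "abs_continuous_on {0..v} x" using assms uv by (auto simp: trajectory_def)
      moreover have "{u..v} \<subseteq> {0..v}" using uv by auto
      ultimately show "abs_continuous_on {u..v} x"
        unfolding abs_continuous_on_def by (meson order_trans)
      show "(x has_vector_derivative A t *v x t) (at t within {u..v})" if "t \<in> {u..v} - E" for t
        using E(2)[of t] that uv by (auto intro: has_vector_derivative_within_subset)
    qed (use uv in simp)
  qed
  with A show thesis by (rule that)
qed

text \<open>Continuity is not part of \<open>solves\<close>; on \<open>{0..T}\<close> it comes from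
  writing \<open>x\<close> as a constant plus an indefinite integral, and compactness then gives the
  bound.\<close>

lemma solves_bounded:
  assumes "solves A x"
  obtains R where "R > 0" "\<And>t. t \<in> {0..T} \<Longrightarrow> norm (x t) \<le> R"
proof -
  have "continuous_on {0..T} (\<lambda>t. x 0 + integral {0..t} (\<lambda>s. A s *v x s))"
    using assms by (intro continuous_intros indefinite_integral_continuous_1)
      (cases "0 \<le> T"; auto simp: solves_def intro: has_integral_integrable)
  moreover have "x 0 + integral {0..t} (\<lambda>s. A s *v x s) = x t" if "t \<ge> 0" for t
    using assms that integral_unique[of "\<lambda>s. A s *v x s" "x t - x 0" "{0..t}"] by (simp add: solves_def)
  ultimately have "continuous_on {0..T} x"
    by (metis (no_types, lifting) atLeastAtMost_iff continuous_on_cong)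
  then have "bounded (x ` {0..T})" by (intro compact_imp_bounded compact_continuous_image) auto
  then show thesis using that by (auto simp: bounded_pos)
qed

lemma switching_law_integrable:
  fixes A :: "real \<Rightarrow> real^'n^'n"
  assumes "bounded M" "switching_law M A" "0 \<le> u"
  shows "A integrable_on {u..v}"
proof -
  obtain C where C: "\<And>X. X \<in> M \<Longrightarrow> norm X \<le> C"
    using bounded_matrices_uniform_bound[OF assms(1)] by metis
  have "A absolutely_integrable_on {u..v}"
  proof (rule measurable_bounded_by_integrable_imp_absolutely_integrable)
    have "{u..v} \<subseteq> {0..}" using assms by auto
    then show "A \<in> borel_measurable (lebesgue_on {u..v})"
      using assms(2) unfolding switching_law_def by (meson measurable_restrict_mono)
    show "(\<lambda>_. C) integrable_on {u..v}" by (rule integrable_const_ivl)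
    show "norm (A t) \<le> C" if "t \<in> {u..v}" for t
      using that assms C unfolding switching_law_def by auto
  qed simp
  then show ?thesis by (rule absolutely_integrable_on_def[THEN iffD1, THEN conjunct1])
qed

text \<open>A mean outside \<open>M\<close> would be strictly separated from \<open>M\<close> by a
  hyperplane; integrating the inequality satisfied by every \<open>A t\<close> puts the mean on the
  side of \<open>M\<close>, a contradiction.\<close>

lemma integral_mean_in_closed_convex:
  fixes A :: "real \<Rightarrow> 'a::euclidean_space"
  assumes "closed M" "convex M" and A: "\<And>t. t \<in> {u..v} \<Longrightarrow> A t \<in> M" "A integrable_on {u..v}" and "u < v"
  shows "(1 / (v - u)) *\<^sub>R integral {u..v} A \<in> M"
proof (rule ccontr)
  assume "(1 / (v - u)) *\<^sub>R integral {u..v} A \<notin> M"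
  then obtain a b where ab: "a \<bullet> ((1 / (v - u)) *\<^sub>R integral {u..v} A) < b" "\<And>X. X \<in> M \<Longrightarrow> a \<bullet> X > b"
    using separating_hyperplane_closed_point[OF assms(2,1)] by metis
  have int: "((\<lambda>t. a \<bullet> A t) has_integral (a \<bullet> integral {u..v} A)) {u..v}"
    using has_integral_linear[OF integrable_integral[OF A(2)] bounded_linear_inner_right[of a]]
    by (simp add: o_def)
  have "((\<lambda>t. b) has_integral (b * (v - u))) {u..v}"
    using has_integral_const_real[of b u v] \<open>u < v\<close> by (simp add: mult.commute)
  from has_integral_le[OF this int] ab(2) A(1) have "b * (v - u) \<le> a \<bullet> integral {u..v} A"
    by (meson less_imp_le)
  with ab(1) \<open>u < v\<close> show False by (simp add: field_simps)
qed

lemma law_primitive_integral: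
  fixes A :: "real \<Rightarrow> real^'n^'n"
  assumes "compact M" "convex M" "switching_law M A"
  shows "law_primitive M (\<lambda>t. integral {0..t} A)"
  unfolding law_primitive_def
proof (intro allI impI)
  fix u v :: real assume uv: "0 \<le> u \<and> u < v"
  note int = switching_law_integrable[OF compact_imp_bounded[OF assms(1)] assms(3)]
  have "integral {0..u} A + integral {u..v} A = integral {0..v} A"
    using uv int[of 0 v] by (intro Henstock_Kurzweil_Integration.integral_combine) auto
  then have "integral {0..v} A - integral {0..u} A = integral {u..v} A"
    by (metis add_diff_cancel_left')
  moreover have "(1 / (v - u)) *\<^sub>R integral {u..v} A \<in> M"
    using assms uv int[of u v]
    by (intro integral_mean_in_closed_convex compact_imp_closed) (auto simp: switching_law_def)
  ultimately show "(1 / (v - u)) *\<^sub>R (integral {0..v} A - integral {0..u} A) \<in> M" by simp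
qed

lemma solves_lipschitz:
  assumes A: "switching_law M A" "solves A x"
    and C: "\<And>X y. X \<in> M \<Longrightarrow> norm (X *v y) \<le> C * norm y" "0 \<le> C"
    and R: "\<And>t. t \<in> {0..T} \<Longrightarrow> norm (x t) \<le> R"
    and uv: "0 \<le> u" "u \<le> v" "v \<le> T"
  shows "norm (x v - x u) \<le> C * R * (v - u)"
proof -
  have R0: "0 \<le> R" using order_trans[OF norm_ge_zero R[of u]] uv by simp
  have "norm (x v - x u) \<le> C * R * measure lborel (cbox u v)"
  proof (rule has_integral_bound)
    show "((\<lambda>s. A s *v x s) has_integral (x v - x u)) (cbox u v)"
      using A(2) uv by (simp add: solves_def)
    fix s assume "s \<in> cbox u v"
    then have s: "s \<ge> 0" "s \<in> {0..T}" using uv by auto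
    have "norm (A s *v x s) \<le> C * norm (x s)" using A(1) s by (intro C) (simp add: switching_law_def)
    also have "\<dots> \<le> C * R" using R[OF s(2)] C(2) by (intro mult_left_mono)
    finally show "norm (A s *v x s) \<le> C * R" .
  qed (use R0 C in simp)
  then show ?thesis using uv by simp
qed

text \<open>Freezing \<open>x\<close> at the left endpoint leaves the integrand
  \<open>A s *v (x s - x u)\<close>, of norm at most \<open>C * (C * R * (v - u))\<close> on an
  interval of length \<open>v - u\<close>. The constant depends only on \<open>C\<close> and
  \<open>R\<close>, so it is common to all trajectories with the same bound.\<close>

lemma solves_imp_driven:
  fixes A :: "real \<Rightarrow> real^'n^'n"
  assumes M: "bounded M" and A: "switching_law M A" "solves A x"
    and C: "\<And>X y. X \<in> M \<Longrightarrow> norm (X *v y) \<le> C * norm y" "0 \<le> C"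
    and R: "\<And>t. t \<in> {0..T} \<Longrightarrow> norm (x t) \<le> R"
  shows "driven (\<lambda>t. integral {0..t} A) (C * (C * R)) T x"
  unfolding driven_def
proof (intro allI impI)
  fix u v :: real assume "0 \<le> u \<and> u \<le> v \<and> v \<le> T"
  then have uv: "0 \<le> u" "u \<le> v" "v \<le> T" by auto
  note int = switching_law_integrable[OF M A(1)]
  have R0: "0 \<le> R" using order_trans[OF norm_ge_zero R[of u]] uv by simp
  have "integral {0..u} A + integral {u..v} A = integral {0..v} A"
    using uv int[of 0 v] by (intro Henstock_Kurzweil_Integration.integral_combine) auto
  then have eq: "integral {0..v} A - integral {0..u} A = integral {u..v} A"
    by (metis add_diff_cancel_left')
  have "((\<lambda>s. A s *v x u) has_integral (integral {u..v} A *v x u)) {u..v}"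
    using has_integral_linear[OF integrable_integral[OF int[of u v]]
        bounded_bilinear.bounded_linear_left[OF bounded_bilinear_matrix_vector_mult, of "x u"]] uv
    by (simp add: o_def)
  with A(2) uv have "((\<lambda>s. A s *v x s - A s *v x u) has_integral (x v - x u - integral {u..v} A *v x u)) {u..v}"
    by (intro has_integral_diff) (auto simp: solves_def)
  then have hi: "((\<lambda>s. A s *v (x s - x u)) has_integral (x v - x u - integral {u..v} A *v x u)) {u..v}"
    by (simp add: matrix_vector_mult_diff_distrib)
  have "norm (x v - x u - integral {u..v} A *v x u) \<le> C * (C * R * (v - u)) * measure lborel (cbox u v)"
  proof (rule has_integral_bound)
    show "((\<lambda>s. A s *v (x s - x u)) has_integral (x v - x u - integral {u..v} A *v x u)) (cbox u v)"
      using hi by simp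
    fix s assume "s \<in> cbox u v"
    then have s: "u \<le> s" "s \<le> v" by auto
    have "norm (A s *v (x s - x u)) \<le> C * norm (x s - x u)"
      using A(1) s uv by (intro C) (simp add: switching_law_def)
    also have "norm (x s - x u) \<le> C * R * (s - u)"
      using s uv by (intro solves_lipschitz[OF A C R]) auto
    also have "C * R * (s - u) \<le> C * R * (v - u)" using s R0 C(2) by (intro mult_left_mono) auto
    finally show "norm (A s *v (x s - x u)) \<le> C * (C * R * (v - u))"
      using C(2) by (simp add: mult_left_mono)
  qed (use R0 C uv in simp)
  also have "\<dots> = C * (C * R) * (v - u)\<^sup>2" using uv by (simp add: power2_eq_square)
  finally show "norm (x v - x u - (integral {0..v} A - integral {0..u} A) *v x u) \<le> C * (C * R) * (v - u)\<^sup>2"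
    by (simp add: eq)
qed

section \<open>From inequalities between increments back to the differential equation\<close>

lemma law_primitive_norm_le:
  assumes "law_primitive M B" and C: "\<And>X. X \<in> M \<Longrightarrow> norm X \<le> C" and "0 \<le> u" "u \<le> v"
  shows "norm (B v - B u) \<le> C * (v - u)"
proof (cases "u = v")
  case False
  with assms have "norm ((1 / (v - u)) *\<^sub>R (B v - B u)) \<le> C"
    by (intro C) (simp add: law_primitive_def)
  also have "norm ((1 / (v - u)) *\<^sub>R (B v - B u)) = norm (B v - B u) / (v - u)"
    using False \<open>u \<le> v\<close> by (simp only: norm_scaleR) simp
  finally show ?thesis using False \<open>u \<le> v\<close> by (simp add: pos_divide_le_eq)
qed simp

lemma law_primitive_mult_norm_le:
  assumes "law_primitive M B" and C: "\<And>X y. X \<in> M \<Longrightarrow> norm (X *v y) \<le> C * norm y" and "0 \<le> u" "u \<le> v"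
  shows "norm ((B v - B u) *v y) \<le> C * (v - u) * norm y"
proof (cases "u = v")
  case False
  with assms have "norm (((1 / (v - u)) *\<^sub>R (B v - B u)) *v y) \<le> C * norm y"
    by (intro C) (simp add: law_primitive_def)
  also have "norm (((1 / (v - u)) *\<^sub>R (B v - B u)) *v y) = norm ((B v - B u) *v y) / (v - u)"
    using False \<open>u \<le> v\<close> by (simp only: scaleR_matrix_vector_assoc[symmetric] norm_scaleR) simp
  finally show ?thesis using False \<open>u \<le> v\<close> by (simp add: pos_divide_le_eq mult_ac)
qed simp

lemma driven_abs: "driven B K T x \<Longrightarrow> driven B \<bar>K\<bar> T x"
  unfolding driven_def
proof (intro allI impI)
  fix u v
  assume "\<forall>u v. 0 \<le> u \<and> u \<le> v \<and> v \<le> T \<longrightarrow> norm (x v - x u - (B v - B u) *v x u) \<le> K * (v - u)\<^sup>2"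
    and "0 \<le> u \<and> u \<le> v \<and> v \<le> T"
  then have "norm (x v - x u - (B v - B u) *v x u) \<le> K * (v - u)\<^sup>2" by simp
  also have "\<dots> \<le> \<bar>K\<bar> * (v - u)\<^sup>2" by (intro mult_right_mono) auto
  finally show "norm (x v - x u - (B v - B u) *v x u) \<le> \<bar>K\<bar> * (v - u)\<^sup>2" .
qed

text \<open>\<open>driven\<close> compares \<open>x t\<close> with \<open>x 0\<close> across all of
  \<open>{0..t}\<close> in one step, which bounds \<open>x\<close> on \<open>{0..T}\<close> by
  \<open>R\<close> without a Gronwall argument. On a bounded interval the quadratic error is at most
  \<open>\<bar>K\<bar> * T * (v - u)\<close>, hence linear.\<close>

lemma driven_lipschitz:
  assumes B: "law_primitive M B" and C: "\<And>X y. X \<in> M \<Longrightarrow> norm (X *v y) \<le> C * norm y" "0 \<le> C"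
    and x: "driven B K T x" and T: "0 \<le> T"
  obtains L where "L \<ge> 0" "\<And>u v. 0 \<le> u \<Longrightarrow> u \<le> v \<Longrightarrow> v \<le> T \<Longrightarrow> norm (x v - x u) \<le> L * (v - u)"
proof -
  have Bn: "norm ((B v - B u) *v y) \<le> C * (v - u) * norm y" if "0 \<le> u" "u \<le> v" for u v y
    by (rule law_primitive_mult_norm_le[OF B C(1) that])
  have x': "norm (x v - x u - (B v - B u) *v x u) \<le> \<bar>K\<bar> * (v - u)\<^sup>2"
    if "0 \<le> u" "u \<le> v" "v \<le> T" for u v
    using driven_abs[OF x] that by (simp add: driven_def)
  have step: "norm (x v - x u) \<le> C * (v - u) * norm (x u) + \<bar>K\<bar> * T * (v - u)"
    if uv: "0 \<le> u" "u \<le> v" "v \<le> T" for u v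
  proof -
    have "norm (x v - x u) \<le> norm (x v - x u - (B v - B u) *v x u) + norm ((B v - B u) *v x u)"
      by (metis add.commute diff_add_cancel norm_triangle_ineq)
    moreover have "\<bar>K\<bar> * (v - u)\<^sup>2 \<le> \<bar>K\<bar> * (T * (v - u))"
      using uv by (intro mult_left_mono) (auto simp: power2_eq_square intro!: mult_right_mono)
    ultimately show ?thesis using x'[OF uv] Bn[OF uv(1,2), of "x u"] by (simp add: mult.assoc)
  qed
  define R where "R = norm (x 0) + C * T * norm (x 0) + \<bar>K\<bar> * T * T"
  have R: "norm (x t) \<le> R" if t: "0 \<le> t" "t \<le> T" for t
  proof -
    have "norm (x t) \<le> norm (x 0) + norm (x t - x 0)" by (metis add.commute diff_add_cancel norm_triangle_ineq)
    also have "norm (x t - x 0) \<le> C * t * norm (x 0) + \<bar>K\<bar> * T * t" using step[of 0 t] t by simp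
    also have "\<dots> \<le> C * T * norm (x 0) + \<bar>K\<bar> * T * T"
      using t C(2) by (intro add_mono mult_mono mult_right_mono mult_left_mono) auto
    finally show ?thesis by (simp add: R_def)
  qed
  show thesis
  proof (rule that[of "C * R + \<bar>K\<bar> * T"])
    have "0 \<le> R" using order_trans[OF norm_ge_zero R[of 0]] T by simp
    then show "0 \<le> C * R + \<bar>K\<bar> * T" using C(2) T by simp
    fix u v assume uv: "0 \<le> u" "u \<le> v" "v \<le> T"
    have "C * (v - u) * norm (x u) \<le> C * (v - u) * R"
      using uv C(2) R[of u] by (intro mult_left_mono) auto
    with step[OF uv] show "norm (x v - x u) \<le> (C * R + \<bar>K\<bar> * T) * (v - u)"
      by (simp add: algebra_simps)
  qed
qed

text \<open>\<open>driven\<close> is anchored at the left endpoint, whereas a derivative needs both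
  directions. Moving the anchor from \<open>y\<close> to \<open>t\<close> costs
  \<open>(B t - B y) *v (x t - x y)\<close>, a product of two Lipschitz increments and hence again
  quadratic.\<close>

lemma driven_two_sided:
  assumes B: "law_primitive M B" and C: "\<And>X y. X \<in> M \<Longrightarrow> norm (X *v y) \<le> C * norm y" "0 \<le> C"
    and x: "driven B K T x" and T: "0 \<le> T"
  obtains K' where "K' \<ge> 0"
    "\<And>t y. t \<in> {0..T} \<Longrightarrow> y \<in> {0..T} \<Longrightarrow> norm (x y - x t - (B y - B t) *v x t) \<le> K' * (y - t)\<^sup>2"
proof -
  obtain L where L: "L \<ge> 0" "\<And>u v. 0 \<le> u \<Longrightarrow> u \<le> v \<Longrightarrow> v \<le> T \<Longrightarrow> norm (x v - x u) \<le> L * (v - u)"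
    using driven_lipschitz[OF B C x T] by blast
  have x': "norm (x v - x u - (B v - B u) *v x u) \<le> \<bar>K\<bar> * (v - u)\<^sup>2"
    if "0 \<le> u" "u \<le> v" "v \<le> T" for u v
    using driven_abs[OF x] that by (simp add: driven_def)
  show thesis
  proof (rule that[of "\<bar>K\<bar> + C * L"])
    show "0 \<le> \<bar>K\<bar> + C * L" using C(2) L(1) by simp
    fix t y assume ty: "t \<in> {0..T}" "y \<in> {0..T}"
    have CL: "0 \<le> C * L * (y - t)\<^sup>2" using C(2) L(1) by simp
    show "norm (x y - x t - (B y - B t) *v x t) \<le> (\<bar>K\<bar> + C * L) * (y - t)\<^sup>2"
    proof (cases "t \<le> y")
      case True
      then show ?thesis using x'[of t y] ty CL by (simp add: distrib_right)
    next
      case False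
      have "x y - x t - (B y - B t) *v x t = - (x t - x y - (B t - B y) *v x y) + (B t - B y) *v (x t - x y)"
        by (simp add: algebra_simps matrix_vector_mult_diff_rdistrib matrix_vector_mult_diff_distrib)
      then have "norm (x y - x t - (B y - B t) *v x t)
          \<le> norm (x t - x y - (B t - B y) *v x y) + norm ((B t - B y) *v (x t - x y))"
        by (metis norm_minus_cancel norm_triangle_ineq)
      also have "norm ((B t - B y) *v (x t - x y)) \<le> C * (t - y) * norm (x t - x y)"
        using False ty by (intro law_primitive_mult_norm_le[OF B C(1)]) auto
      also have "\<dots> \<le> C * (t - y) * (L * (t - y))"
        using False ty C(2) L(2)[of y t] by (intro mult_left_mono) auto
      also have "\<dots> = C * L * (y - t)\<^sup>2" by (simp add: power2_eq_square algebra_simps)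
      also have "norm (x t - x y - (B t - B y) *v x y) \<le> \<bar>K\<bar> * (t - y)\<^sup>2"
        using False ty by (intro x') auto
      finally show ?thesis by (simp add: distrib_right power2_commute)
    qed
  qed
qed

lemma has_vector_derivative_zero_quadratic:
  fixes r :: "real \<Rightarrow> 'a::real_normed_vector"
  assumes r: "\<And>y. y \<in> S \<Longrightarrow> \<bar>y - t\<bar> < 1 \<Longrightarrow> norm (r y) \<le> K * (y - t)\<^sup>2" and "K \<ge> 0" "r t = 0"
  shows "(r has_vector_derivative 0) (at t within S)"
  unfolding has_vector_derivative_def has_derivative_within_alt
proof (intro conjI allI impI bounded_linear_scaleR_left)
  fix e :: real assume "e > 0"
  show "\<exists>d>0. \<forall>y\<in>S. norm (y - t) < d \<longrightarrow> norm (r y - r t - (y - t) *\<^sub>R 0) \<le> e * norm (y - t)"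
  proof (intro exI[of _ "min 1 (e / (K + 1))"] conjI ballI impI)
    show "min 1 (e / (K + 1)) > 0" using \<open>e > 0\<close> \<open>K \<ge> 0\<close> by simp
    fix y assume y: "y \<in> S" "norm (y - t) < min 1 (e / (K + 1))"
    have "K * \<bar>y - t\<bar> \<le> (K + 1) * \<bar>y - t\<bar>" by (simp add: distrib_right)
    also have "\<dots> \<le> e" using y(2) \<open>K \<ge> 0\<close> by (simp add: field_simps)
    finally have "K * \<bar>y - t\<bar> * \<bar>y - t\<bar> \<le> e * \<bar>y - t\<bar>" by (rule mult_right_mono) simp
    with r[OF y(1)] y(2) show "norm (r y - r t - (y - t) *\<^sub>R 0) \<le> e * norm (y - t)"
      using \<open>r t = 0\<close> by (simp add: power2_eq_square mult.assoc)
  qed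
qed

text \<open>A countable limit passes on both membership in a closed set and measurability. The steps
  are forward, so that they do not leave the half-line.\<close>

lemma has_vector_derivative_imp_quotients_tendsto:
  fixes f :: "real \<Rightarrow> 'a::real_normed_vector"
  assumes "(f has_vector_derivative D) (at t)"
  shows "(\<lambda>n. real (Suc n) *\<^sub>R (f (t + 1 / real (Suc n)) - f t)) \<longlonglongrightarrow> D"
proof -
  have lim: "((\<lambda>h. norm (f (t + h) - f t - h *\<^sub>R D) / norm h) \<longlongrightarrow> 0) (at 0)"
    using assms by (simp add: has_vector_derivative_def has_derivative_at)
  have "filterlim (\<lambda>n. 1 / real (Suc n)) (at 0) sequentially"
    using LIMSEQ_Suc[OF lim_1_over_n] by (simp add: filterlim_at del: of_nat_Suc)
  from filterlim_compose[OF lim this]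
  have "(\<lambda>n. norm (f (t + 1 / real (Suc n)) - f t - (1 / real (Suc n)) *\<^sub>R D) / norm (1 / real (Suc n))) \<longlonglongrightarrow> 0" .
  moreover have "norm (f (t + 1 / real (Suc n)) - f t - (1 / real (Suc n)) *\<^sub>R D) / norm (1 / real (Suc n))
      = norm (real (Suc n) *\<^sub>R (f (t + 1 / real (Suc n)) - f t) - D)" for n
  proof -
    have "real (Suc n) *\<^sub>R (f (t + 1 / real (Suc n)) - f t) - D
        = real (Suc n) *\<^sub>R (f (t + 1 / real (Suc n)) - f t - (1 / real (Suc n)) *\<^sub>R D)"
      by (simp add: scaleR_right_diff_distrib)
    then show ?thesis by (simp only: norm_scaleR) (simp add: field_simps)
  qed
  ultimately show ?thesis by (simp add: tendsto_norm_zero_iff LIM_zero_iff)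
qed

text \<open>Boundedness of \<open>M\<close> makes \<open>B\<close> Lipschitz, hence differentiable
  almost everywhere. The derivative is a limit of forward quotients that lie in the closed set
  \<open>M\<close> and depend continuously on time, which gives both \<open>A t \<in> M\<close> and
  measurability.\<close>

lemma law_primitive_derivative:
  fixes B :: "real \<Rightarrow> real^'n^'n"
  assumes M: "compact M" and B: "law_primitive M B"
  obtains A N where "switching_law M A" "negligible N"
    "\<And>t. t \<ge> 0 \<Longrightarrow> t \<notin> N \<Longrightarrow> (B has_vector_derivative A t) (at t within {0..})"
proof -
  obtain C where C: "C > 0" "\<And>X. X \<in> M \<Longrightarrow> norm X \<le> C"
    using bounded_matrices_uniform_bound[OF compact_imp_bounded[OF M]] by metis
  \<comment> \<open>\<open>B\<close> is continued as a constant to negative times, because the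
    theorem on Lipschitz functions concerns the whole line. Derivatives at positive times are
    unaffected.\<close>
  define Bt where "Bt t = B (max 0 t)" for t
  have mono: "norm (Bt v - Bt u) \<le> C * (v - u)" if "u \<le> v" for u v
  proof -
    have "norm (Bt v - Bt u) \<le> C * (max 0 v - max 0 u)"
      unfolding Bt_def using that by (intro law_primitive_norm_le[OF B C(2)]) auto
    also have "\<dots> \<le> C * (v - u)" using that C(1) by (intro mult_left_mono) auto
    finally show ?thesis .
  qed
  have lip: "norm (Bt v - Bt u) \<le> C * \<bar>v - u\<bar>" for u v
    using mono[of u v] mono[of v u] by (cases "u \<le> v") (auto simp: norm_minus_commute)
  have cont: "continuous_on UNIV Bt"
    by (rule lipschitz_on_continuous_on[of C])
      (use lip C(1) in \<open>auto simp: lipschitz_on_def dist_norm\<close>)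
  define N where "N = {t. \<not> Bt differentiable (at t)}"
  have N: "negligible N" unfolding N_def by (rule lipschitz_differentiable_AE[OF lip])
  \<comment> \<open>A law takes values in \<open>M\<close> at every time, also on the null set
    without a derivative; the quotient over \<open>{0..1}\<close> is a default value in
    \<open>M\<close>.\<close>
  define A0 where "A0 = (1 / (1 - 0)) *\<^sub>R (B 1 - B 0)"
  have A0: "A0 \<in> M" using B zero_less_one order_refl unfolding law_primitive_def A0_def by blast
  define S where "S = {0<..} - N"
  have S: "S \<in> sets lebesgue" using N by (auto simp: S_def negligible_imp_sets)
  define A where "A t = (if t \<in> S then vector_derivative Bt (at t) else A0)" for t
  have der: "(Bt has_vector_derivative A t) (at t)" if "t \<in> S" for t
    using that by (simp add: A_def S_def N_def vector_derivative_works)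
  define q where "q n t = real (Suc n) *\<^sub>R (Bt (t + 1 / real (Suc n)) - Bt t)" for n t
  have q: "(\<lambda>n. q n t) \<longlonglongrightarrow> A t" if "t \<in> S" for t
    unfolding q_def by (rule has_vector_derivative_imp_quotients_tendsto[OF der[OF that]])
  have qM: "q n t \<in> M" if "t \<ge> 0" for n t
  proof -
    have "(1 / h) *\<^sub>R (B (t + h) - B t) \<in> M" if "h > 0" for h
      using B[unfolded law_primitive_def, rule_format, of t "t + h"] that \<open>t \<ge> 0\<close> by simp
    from this[of "1 / real (Suc n)"]
    have "real (Suc n) *\<^sub>R (B (t + 1 / real (Suc n)) - B t) \<in> M" by (simp del: of_nat_Suc)
    moreover have "Bt (t + 1 / real (Suc n)) = B (t + 1 / real (Suc n))" "Bt t = B t"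
      using that by (auto simp: Bt_def max_def simp del: of_nat_Suc)
    ultimately show ?thesis by (simp add: q_def)
  qed
  have AM: "A t \<in> M" for t
  proof (cases "t \<in> S")
    case True
    then have "q n t \<in> M" for n by (intro qM) (simp add: S_def)
    then show ?thesis
      by (rule closed_sequentially[OF compact_imp_closed[OF M] _ q[OF True]])
  qed (simp add: A_def A0)
  have "switching_law M A"
    unfolding switching_law_def
  proof (intro conjI allI impI AM)
    show "A \<in> borel_measurable (lebesgue_on {0..})"
    proof (rule borel_measurable_LIMSEQ_metric)
      show "(\<lambda>n. if t \<in> S then q n t else A0) \<longlonglongrightarrow> A t" for t
        using q[of t] by (cases "t \<in> S") (simp_all add: A_def)
      fix n
      have "continuous_on UNIV (q n)"
        unfolding q_def by (intro continuous_intros continuous_on_compose2[OF cont]) auto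
      then have "q n \<in> borel_measurable lborel" by (simp add: borel_measurable_continuous_onI)
      then have "q n \<in> borel_measurable lebesgue" by (rule measurable_completion)
      then have "(\<lambda>t. if t \<in> S then q n t else A0) \<in> borel_measurable lebesgue"
        using S by (intro measurable_If_set) auto
      then show "(\<lambda>t. if t \<in> S then q n t else A0) \<in> borel_measurable (lebesgue_on {0..})"
        by (rule measurable_restrict_space1)
    qed
  qed
  moreover have "negligible (insert 0 N)" using N by simp
  moreover have "(B has_vector_derivative A t) (at t within {0..})" if "t \<ge> 0" "t \<notin> insert 0 N" for t
  proof -
    have "t \<in> S" using that by (auto simp: S_def)
    from has_vector_derivative_at_within[OF der[OF this]]
    show ?thesis
      by (rule has_vector_derivative_transform[rotated 2]) (use that in \<open>auto simp: Bt_def\<close>)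
  qed
  ultimately show thesis by (rule that)
qed

text \<open>At a time where \<open>B\<close> has the derivative \<open>A t\<close>, the quadratic
  error contributes nothing to the derivative of \<open>x\<close>, and \<open>A t *v x t\<close>
  remains. \<open>K\<close> may depend on \<open>T\<close>, since absolute continuity is only
  required locally.\<close>

lemma driven_imp_trajectory:
  fixes B :: "real \<Rightarrow> real^'n^'n"
  assumes M: "compact M" and B: "law_primitive M B"
    and x: "\<And>T. T \<ge> 0 \<Longrightarrow> \<exists>K. driven B K T x"
  shows "trajectory M x"
  unfolding trajectory_def
proof (intro conjI allI impI)
  obtain C where C: "C > 0" "\<And>X y. X \<in> M \<Longrightarrow> norm (X *v y) \<le> C * norm y"
    using bounded_matrices_uniform_bound[OF compact_imp_bounded[OF M]] by metis
  then have C0: "0 \<le> C" by simp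
  show "abs_continuous_on {0..T} x" if T: "T \<ge> 0" for T
  proof -
    obtain K where "driven B K T x" using x[OF T] ..
    from driven_lipschitz[OF B C(2) C0 this T]
    obtain L where "\<And>u v. 0 \<le> u \<Longrightarrow> u \<le> v \<Longrightarrow> v \<le> T \<Longrightarrow> norm (x v - x u) \<le> L * (v - u)"
      by blast
    then show ?thesis by (intro abs_continuous_on_lipschitz[of _ _ _ L]) auto
  qed
  obtain A N where A: "switching_law M A" and N: "negligible N"
    and der: "\<And>t. t \<ge> 0 \<Longrightarrow> t \<notin> N \<Longrightarrow> (B has_vector_derivative A t) (at t within {0..})"
    using law_primitive_derivative[OF M B] by blast
  have xder: "(x has_vector_derivative A t *v x t) (at t within {0..})" if t: "t \<ge> 0" "t \<notin> N" for t
  proof -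
    \<comment> \<open>The horizon \<open>t + 1\<close> covers a full neighbourhood of
      \<open>t\<close> in \<open>{0..}\<close>.\<close>
    obtain K where "driven B K (t + 1) x" using x[of "t + 1"] t by auto
    moreover have "0 \<le> t + 1" using t by simp
    ultimately obtain K' where K': "K' \<ge> 0"
      "\<And>s y. s \<in> {0..t + 1} \<Longrightarrow> y \<in> {0..t + 1} \<Longrightarrow> norm (x y - x s - (B y - B s) *v x s) \<le> K' * (y - s)\<^sup>2"
      using driven_two_sided[OF B C(2) C0] by blast
    have bound: "norm (x y - x t - (B y - B t) *v x t) \<le> K' * (y - t)\<^sup>2"
      if "y \<in> {0..}" "\<bar>y - t\<bar> < 1" for y
      using that t by (intro K'(2)) auto
    have "((\<lambda>y. x y - x t - (B y - B t) *v x t) has_vector_derivative 0) (at t within {0..})"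
      by (rule has_vector_derivative_zero_quadratic[OF bound K'(1)]) simp_all
    moreover have "((\<lambda>y. (B y - B t) *v x t) has_vector_derivative A t *v x t) (at t within {0..})"
    proof (rule bounded_linear.has_vector_derivative
        [OF bounded_bilinear.bounded_linear_left[OF bounded_bilinear_matrix_vector_mult]])
      show "((\<lambda>y. B y - B t) has_vector_derivative A t) (at t within {0..})"
        using has_vector_derivative_diff[OF der[OF t] has_vector_derivative_const[of "B t"]] by simp
    qed
    ultimately have "((\<lambda>y. (x y - x t - (B y - B t) *v x t) + (B y - B t) *v x t + x t)
        has_vector_derivative 0 + A t *v x t + 0) (at t within {0..})"
      by (intro has_vector_derivative_add has_vector_derivative_const)
    then show ?thesis by simp
  qed
  have "AE t in lebesgue. t \<in> {0..} \<longrightarrow> (x has_vector_derivative A t *v x t) (at t within {0..})"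
    unfolding eventually_ae_filter_negligible using N xder by (intro exI[of _ N]) auto
  then have "AE t in lebesgue_on {0..}. (x has_vector_derivative A t *v x t) (at t within {0..})"
    by (simp add: AE_restrict_space_iff)
  with A show "\<exists>A. switching_law M A \<and>
      (AE t in lebesgue_on {0..}. (x has_vector_derivative A t *v x t) (at t within {0..}))"
    by blast
qed

lemma solves_imp_trajectory:
  assumes M: "compact M" "convex M" and A: "switching_law M A" "solves A x"
  shows "trajectory M x"
proof (rule driven_imp_trajectory[OF M(1) law_primitive_integral[OF M A(1)]])
  fix T :: real
  obtain C where C: "C > 0" "\<And>X y. X \<in> M \<Longrightarrow> norm (X *v y) \<le> C * norm y"
    using bounded_matrices_uniform_bound[OF compact_imp_bounded[OF M(1)]] by metis
  obtain R where "\<And>t. t \<in> {0..T} \<Longrightarrow> norm (x t) \<le> R"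
    using solves_bounded[OF A(2)] by metis
  from solves_imp_driven[OF compact_imp_bounded[OF M(1)] A C(2) _ this] C(1)
  show "\<exists>K. driven (\<lambda>t. integral {0..t} A) K T x" by fastforce
qed

text \<open>The right-hand side mentions neither measurability nor derivatives, so operations on
  trajectories reduce to checking inequalities.\<close>

lemma trajectory_iff_driven:
  assumes "compact M" "convex M"
  shows "trajectory M x \<longleftrightarrow> (\<exists>B. law_primitive M B \<and> (\<forall>T\<ge>0. \<exists>K. driven B K T x))"
proof
  assume "trajectory M x"
  then obtain A where A: "switching_law M A" "solves A x" by (rule trajectory_imp_solves)
  obtain C where C: "C > 0" "\<And>X y. X \<in> M \<Longrightarrow> norm (X *v y) \<le> C * norm y"
    using bounded_matrices_uniform_bound[OF compact_imp_bounded[OF assms(1)]] by metis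
  have "\<exists>K. driven (\<lambda>t. integral {0..t} A) K T x" for T
  proof -
    obtain R where "\<And>t. t \<in> {0..T} \<Longrightarrow> norm (x t) \<le> R"
      using solves_bounded[OF A(2)] by metis
    from solves_imp_driven[OF compact_imp_bounded[OF assms(1)] A C(2) _ this] C(1)
    show ?thesis by fastforce
  qed
  with law_primitive_integral[OF assms A(1)] show "\<exists>B. law_primitive M B \<and> (\<forall>T\<ge>0. \<exists>K. driven B K T x)"
    by blast
qed (use driven_imp_trajectory[OF assms(1)] in blast)

section \<open>Shifts, multiples and concatenations of trajectories\<close>

lemma trajectory_shift:
  assumes M: "compact M" "convex M" and x: "trajectory M x" and s: "0 \<le> s"
  shows "trajectory M (\<lambda>t. x (s + t))"
proof -
  obtain B where B: "law_primitive M B" "\<And>T. T \<ge> 0 \<Longrightarrow> \<exists>K. driven B K T x"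
    using x trajectory_iff_driven[OF M] by blast
  have "law_primitive M (\<lambda>t. B (s + t))"
    unfolding law_primitive_def
  proof (intro allI impI)
    fix u v :: real assume "0 \<le> u \<and> u < v"
    then show "(1 / (v - u)) *\<^sub>R (B (s + v) - B (s + u)) \<in> M"
      using B(1)[unfolded law_primitive_def, rule_format, of "s + u" "s + v"] s by simp
  qed
  moreover have "\<exists>K. driven (\<lambda>t. B (s + t)) K T (\<lambda>t. x (s + t))" if T: "T \<ge> 0" for T
  proof -
    obtain K where K: "driven B K (s + T) x" using B(2)[of "s + T"] T s by auto
    have "driven (\<lambda>t. B (s + t)) K T (\<lambda>t. x (s + t))"
      unfolding driven_def
    proof (intro allI impI)
      fix u v :: real assume "0 \<le> u \<and> u \<le> v \<and> v \<le> T"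
      then show "norm (x (s + v) - x (s + u) - (B (s + v) - B (s + u)) *v x (s + u)) \<le> K * (v - u)\<^sup>2"
        using K[unfolded driven_def, rule_format, of "s + u" "s + v"] s by simp
    qed
    then show ?thesis ..
  qed
  ultimately show ?thesis using trajectory_iff_driven[OF M] by blast
qed

lemma trajectory_scaleR:
  assumes M: "compact M" "convex M" and x: "trajectory M x"
  shows "trajectory M (\<lambda>t. c *\<^sub>R x t)"
proof -
  obtain B where B: "law_primitive M B" "\<And>T. T \<ge> 0 \<Longrightarrow> \<exists>K. driven B K T x"
    using x trajectory_iff_driven[OF M] by blast
  have "\<exists>K. driven B K T (\<lambda>t. c *\<^sub>R x t)" if T: "T \<ge> 0" for T
  proof -
    obtain K where K: "driven B K T x" using B(2)[OF T] by auto
    have "driven B (\<bar>c\<bar> * K) T (\<lambda>t. c *\<^sub>R x t)"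
      unfolding driven_def
    proof (intro allI impI)
      fix u v :: real assume "0 \<le> u \<and> u \<le> v \<and> v \<le> T"
      then have "norm (x v - x u - (B v - B u) *v x u) \<le> K * (v - u)\<^sup>2"
        using K by (simp add: driven_def)
      moreover have "c *\<^sub>R x v - c *\<^sub>R x u - (B v - B u) *v (c *\<^sub>R x u)
          = c *\<^sub>R (x v - x u - (B v - B u) *v x u)"
        by (simp add: matrix_vector_mult_scaleR scaleR_diff_right)
      ultimately show "norm (c *\<^sub>R x v - c *\<^sub>R x u - (B v - B u) *v (c *\<^sub>R x u)) \<le> \<bar>c\<bar> * K * (v - u)\<^sup>2"
        by (simp only: norm_scaleR mult.assoc) (rule mult_left_mono, simp_all)
    qed
    then show ?thesis ..
  qed
  with B(1) show ?thesis using trajectory_iff_driven[OF M] by blast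
qed

lemma trajectory_concat:
  assumes M: "compact M" "convex M" and x: "trajectory M x" and z: "trajectory M z"
    and s: "0 \<le> s" and join: "z 0 = x s"
  shows "trajectory M (\<lambda>t. if t \<le> s then x t else z (t - s))"
proof -
  obtain B1 where B1: "law_primitive M B1" "\<And>T. T \<ge> 0 \<Longrightarrow> \<exists>K. driven B1 K T x"
    using x trajectory_iff_driven[OF M] by blast
  obtain B2 where B2: "law_primitive M B2" "\<And>T. T \<ge> 0 \<Longrightarrow> \<exists>K. driven B2 K T z"
    using z trajectory_iff_driven[OF M] by blast
  obtain C where C: "C > 0" "\<And>X y. X \<in> M \<Longrightarrow> norm (X *v y) \<le> C * norm y"
    using bounded_matrices_uniform_bound[OF compact_imp_bounded[OF M(1)]] by metis
  \<comment> \<open>Adding a constant to the shifted \<open>B2\<close> makes the two primitives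
    agree at time \<open>s\<close>.\<close>
  define B where "B t = (if t \<le> s then B1 t else B1 s + (B2 (t - s) - B2 0))" for t
  define w where "w t = (if t \<le> s then x t else z (t - s))" for t
  have lo: "B t = B1 t" "w t = x t" if "t \<le> s" for t
    using that by (simp_all add: B_def w_def)
  have hi: "B t = B1 s + (B2 (t - s) - B2 0)" "w t = z (t - s)" if "t \<ge> s" for t
    using that join by (auto simp: B_def w_def)
  have "law_primitive M B"
    unfolding law_primitive_def
  proof (intro allI impI)
    fix u v :: real assume uv: "0 \<le> u \<and> u < v"
    consider "v \<le> s" | "s \<le> u" | "u < s" "s < v" by linarith
    then show "(1 / (v - u)) *\<^sub>R (B v - B u) \<in> M"
    proof cases
      case 1
      then show ?thesis using B1(1) uv by (simp add: lo law_primitive_def)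
    next
      case 2
      then show ?thesis
        using B2(1)[unfolded law_primitive_def, rule_format, of "u - s" "v - s"] uv by (simp add: hi)
    next
      case 3
      let ?Q1 = "(1 / (s - u)) *\<^sub>R (B1 s - B1 u)" and ?Q2 = "(1 / (v - s)) *\<^sub>R (B2 (v - s) - B2 0)"
      have Q1: "?Q1 \<in> M" using B1(1) 3 uv by (simp add: law_primitive_def)
      have Q2: "?Q2 \<in> M"
        using B2(1)[unfolded law_primitive_def, rule_format, of 0 "v - s"] 3 by simp
      \<comment> \<open>A quotient across the junction is the average of the quotients on either
        side, weighted by the lengths of the two parts; convexity of \<open>M\<close> is used
        here.\<close>
      have "((s - u) / (v - u)) *\<^sub>R ?Q1 + ((v - s) / (v - u)) *\<^sub>R ?Q2 \<in> M"
        using 3 by (intro convexD[OF M(2) Q1 Q2]) (simp_all add: add_divide_distrib[symmetric])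
      also have "((s - u) / (v - u)) *\<^sub>R ?Q1 + ((v - s) / (v - u)) *\<^sub>R ?Q2 = (1 / (v - u)) *\<^sub>R (B v - B u)"
        using 3 by (simp add: hi(1)[of v] lo(1)[of u] scaleR_add_right[symmetric] scaleR_diff_right[symmetric])
      finally show ?thesis .
    qed
  qed
  moreover have "\<exists>K. driven B K T w" if T: "T \<ge> 0" for T
  proof -
    obtain K1 where K1: "driven B1 K1 s x" using B1(2)[OF s] ..
    obtain K2 where K2: "driven B2 K2 T z" using B2(2)[OF T] ..
    obtain L where L: "L \<ge> 0" "\<And>u v. 0 \<le> u \<Longrightarrow> u \<le> v \<Longrightarrow> v \<le> s \<Longrightarrow> norm (x v - x u) \<le> L * (v - u)"
      using driven_lipschitz[OF B1(1) C(2) less_imp_le[OF C(1)] K1 s] by blast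
    have d1: "norm (x v - x u - (B1 v - B1 u) *v x u) \<le> \<bar>K1\<bar> * (v - u)\<^sup>2"
      if "0 \<le> u" "u \<le> v" "v \<le> s" for u v using driven_abs[OF K1] that by (simp add: driven_def)
    have d2: "norm (z v - z u - (B2 v - B2 u) *v z u) \<le> \<bar>K2\<bar> * (v - u)\<^sup>2"
      if "0 \<le> u" "u \<le> v" "v \<le> T" for u v using driven_abs[OF K2] that by (simp add: driven_def)
    define K where "K = \<bar>K1\<bar> + \<bar>K2\<bar> + C * L"
    have KK: "\<bar>K1\<bar> \<le> K" "\<bar>K2\<bar> \<le> K" using C(1) L(1) by (simp_all add: K_def)
    have "driven B K T w"
      unfolding driven_def
    proof (intro allI impI)
      fix u v :: real assume "0 \<le> u \<and> u \<le> v \<and> v \<le> T"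
      then have uv: "0 \<le> u" "u \<le> v" "v \<le> T" by auto
      consider "v \<le> s" | "s \<le> u" | "u < s" "s < v" by linarith
      then show "norm (w v - w u - (B v - B u) *v w u) \<le> K * (v - u)\<^sup>2"
      proof cases
        case 1
        have "norm (w v - w u - (B v - B u) *v w u) \<le> \<bar>K1\<bar> * (v - u)\<^sup>2"
          using d1[of u v] 1 uv by (simp add: lo)
        also have "\<dots> \<le> K * (v - u)\<^sup>2" using KK by (intro mult_right_mono) auto
        finally show ?thesis .
      next
        case 2
        have "norm (w v - w u - (B v - B u) *v w u) \<le> \<bar>K2\<bar> * (v - u)\<^sup>2"
          using d2[of "u - s" "v - s"] 2 uv s by (simp add: hi)
        also have "\<dots> \<le> K * (v - u)\<^sup>2" using KK by (intro mult_right_mono) auto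
        finally show ?thesis .
      next
        case 3
        \<comment> \<open>The first two terms are the errors of the two pieces. The third arises
          because the second error is anchored at \<open>x s\<close> instead of \<open>x u\<close>;
          it accounts for the summand \<open>C * L\<close> of \<open>K\<close>.\<close>
        have "w v - w u - (B v - B u) *v w u
            = (z (v - s) - z 0 - (B2 (v - s) - B2 0) *v z 0) + (x s - x u - (B1 s - B1 u) *v x u)
              + (B2 (v - s) - B2 0) *v (x s - x u)"
          using 3 by (simp add: hi[of v] lo[of u] join algebra_simps matrix_vector_mult_diff_rdistrib
              matrix_vector_mult_diff_distrib matrix_vector_mult_add_rdistrib)
        then have "norm (w v - w u - (B v - B u) *v w u)
            \<le> norm (z (v - s) - z 0 - (B2 (v - s) - B2 0) *v z 0) + norm (x s - x u - (B1 s - B1 u) *v x u)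
              + norm ((B2 (v - s) - B2 0) *v (x s - x u))"
          by (simp only:) (rule order_trans[OF norm_triangle_ineq add_right_mono[OF norm_triangle_ineq]])
        also have "norm (z (v - s) - z 0 - (B2 (v - s) - B2 0) *v z 0) \<le> \<bar>K2\<bar> * (v - s)\<^sup>2"
          using d2[of 0 "v - s"] 3 uv s by simp
        also have "\<dots> \<le> \<bar>K2\<bar> * (v - u)\<^sup>2" using 3 by (intro mult_left_mono power_mono) auto
        also have "norm (x s - x u - (B1 s - B1 u) *v x u) \<le> \<bar>K1\<bar> * (s - u)\<^sup>2"
          using d1[of u s] 3 uv by simp
        also have "\<dots> \<le> \<bar>K1\<bar> * (v - u)\<^sup>2" using 3 by (intro mult_left_mono power_mono) auto
        also have "norm ((B2 (v - s) - B2 0) *v (x s - x u)) \<le> C * (v - s - 0) * norm (x s - x u)"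
          using 3 by (intro law_primitive_mult_norm_le[OF B2(1) C(2)]) auto
        also have "\<dots> \<le> C * (v - u) * (L * (v - u))"
        proof (rule mult_mono)
          show "norm (x s - x u) \<le> L * (v - u)"
            using L(2)[of u s] 3 uv mult_left_mono[of "s - u" "v - u" L] L(1) by linarith
        qed (use 3 C(1) in auto)
        also have "\<bar>K2\<bar> * (v - u)\<^sup>2 + \<bar>K1\<bar> * (v - u)\<^sup>2 + C * (v - u) * (L * (v - u)) = K * (v - u)\<^sup>2"
          by (simp add: K_def power2_eq_square algebra_simps)
        finally show ?thesis by simp
      qed
    qed
    then show ?thesis ..
  qed
  ultimately have "trajectory M w" using trajectory_iff_driven[OF M] by blast
  then show ?thesis by (simp add: w_def[abs_def])
qed

section \<open>Compactness of bounded families of trajectories under pointwise convergence\<close>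

lemma lipschitz_pointwise_convergent_subseq:
  fixes f :: "nat \<Rightarrow> real \<Rightarrow> 'a::euclidean_space"
  assumes lip: "\<And>k u v. norm (f k v - f k u) \<le> L * \<bar>v - u\<bar>" and bound: "\<And>k. norm (f k 0) \<le> R"
  obtains r g where "strict_mono (r :: nat \<Rightarrow> nat)" "\<And>t. (\<lambda>k. f (r k) t) \<longlonglongrightarrow> g t"
proof -
  have "L \<ge> 0" using order_trans[OF norm_ge_zero lip[of 0 1 0]] by simp
  \<comment> \<open>The values at rational times form a point of a countable product of compact
    balls, whose sequential compactness takes the place of a diagonal argument. The Lipschitz bound
    extends convergence to real times.\<close>
  define F where "F k q = f k (of_rat q)" for k and q :: rat
  define S where "S = Pi\<^sub>E UNIV (\<lambda>q :: rat. cball (0 :: 'a) (R + L * \<bar>of_rat q\<bar>))"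
  have "compactin (product_topology (\<lambda>_ :: rat. euclidean) UNIV) S"
    unfolding S_def compactin_PiE by (simp add: compactin_euclidean_iff)
  then have "compact S" by (simp add: euclidean_product_topology compactin_euclidean_iff)
  then have "seq_compact S" by (rule compact_imp_seq_compact)
  moreover have "F k \<in> S" for k
  proof -
    have "norm (F k q) \<le> R + L * \<bar>of_rat q\<bar>" for q
    proof -
      have "norm (F k q) \<le> norm (f k 0) + norm (f k (of_rat q) - f k 0)"
        unfolding F_def by (metis add.commute diff_add_cancel norm_triangle_ineq)
      also have "\<dots> \<le> R + L * \<bar>of_rat q\<bar>"
        using bound[of k] lip[of k "of_rat q" 0] by simp
      finally show ?thesis .
    qed
    then show ?thesis by (simp add: S_def PiE_iff)
  qed
  ultimately obtain l r where r: "strict_mono r" and l: "(F \<circ> r) \<longlonglongrightarrow> l"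
    unfolding seq_compact_def by meson
  have Fq: "convergent (\<lambda>k. f (r k) (of_rat q))" for q
    using continuous_on_tendsto_compose[where f = "\<lambda>x. x q", OF continuous_on_product_coordinates l]
    by (auto simp: F_def o_def convergent_def)
  have "convergent (\<lambda>k. f (r k) t)" for t
  proof (rule Cauchy_convergent, rule metric_CauchyI)
    fix e :: real assume "e > 0"
    \<comment> \<open>Chosen so that moving from \<open>t\<close> to a rational time costs at most
      \<open>e / 3\<close>; the \<open>+ 1\<close> keeps the denominator positive when
      \<open>L = 0\<close>.\<close>
    define d where "d = e / (3 * (L + 1))"
    have "d > 0" using \<open>e > 0\<close> \<open>L \<ge> 0\<close> by (simp add: d_def)
    then obtain q where q: "t < of_rat q" "of_rat q < t + d"
      using of_rat_dense[of t "t + d"] by auto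
    have "L * \<bar>t - of_rat q\<bar> \<le> (L + 1) * d" using q \<open>L \<ge> 0\<close> by (intro mult_mono) auto
    also have "\<dots> = e / 3" using \<open>L \<ge> 0\<close> by (simp add: d_def field_simps)
    finally have near: "dist (f k t) (f k (of_rat q)) \<le> e / 3" for k
      using lip[of k t "of_rat q"] by (simp add: dist_norm)
    obtain N where N: "\<And>m n. m \<ge> N \<Longrightarrow> n \<ge> N \<Longrightarrow> dist (f (r m) (of_rat q)) (f (r n) (of_rat q)) < e / 3"
      using metric_CauchyD[OF convergent_Cauchy[OF Fq[of q]], of "e / 3"] \<open>e > 0\<close> by auto
    have "dist (f (r m) t) (f (r n) t) < e" if "m \<ge> N" "n \<ge> N" for m n
    proof -
      have "dist (f (r m) t) (f (r n) t)
          \<le> dist (f (r m) t) (f (r m) (of_rat q)) + dist (f (r m) (of_rat q)) (f (r n) (of_rat q))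
            + dist (f (r n) t) (f (r n) (of_rat q))"
        using dist_triangle[of "f (r m) t" "f (r n) t" "f (r m) (of_rat q)"]
          dist_triangle[of "f (r m) (of_rat q)" "f (r n) t" "f (r n) (of_rat q)"] by (simp add: dist_commute)
      also have "\<dots> < e" using near[of "r m"] near[of "r n"] N[OF that] by linarith
      finally show ?thesis .
    qed
    then show "\<exists>N. \<forall>m\<ge>N. \<forall>n\<ge>N. dist (f (r m) t) (f (r n) t) < e" by blast
  qed
  then have "\<And>t. (\<lambda>k. f (r k) t) \<longlonglongrightarrow> lim (\<lambda>k. f (r k) t)" by (simp add: convergent_LIMSEQ_iff)
  with r show thesis by (rule that)
qed

text \<open>Trajectory and primitive must converge along the same subsequence, so the pair is
  treated as one Lipschitz function. \<open>law_primitive\<close> survives the limit because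
  \<open>M\<close> is closed, and \<open>driven\<close> because its constant
  \<open>C * (C * R)\<close> is the same for all \<open>k\<close>.\<close>

lemma trajectories_pointwise_compact:
  assumes M: "compact M" "convex M" and x: "\<And>k. trajectory M (x k)"
    and R: "\<And>k t. t \<ge> 0 \<Longrightarrow> norm (x k t) \<le> R"
  obtains r y where "strict_mono (r :: nat \<Rightarrow> nat)" "trajectory M y"
    "\<And>t. t \<ge> 0 \<Longrightarrow> (\<lambda>k. x (r k) t) \<longlonglongrightarrow> y t"
proof -
  note bM = compact_imp_bounded[OF M(1)]
  obtain C where C: "C > 0" "\<And>X. X \<in> M \<Longrightarrow> norm X \<le> C" "\<And>X y. X \<in> M \<Longrightarrow> norm (X *v y) \<le> C * norm y"
    using bounded_matrices_uniform_bound[OF bM] by metis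
  have C0: "0 \<le> C" using C(1) by simp
  have "\<exists>A. switching_law M A \<and> solves A (x k)" for k
    using trajectory_imp_solves[OF x[of k]] by metis
  then obtain A where A: "\<And>k. switching_law M (A k)" "\<And>k. solves (A k) (x k)" by metis
  define B where "B k t = integral {0..t} (A k)" for k t
  have B: "law_primitive M (B k)" for k
    unfolding B_def by (rule law_primitive_integral[OF M A(1)])
  \<comment> \<open>Values of \<open>x k\<close> at negative times are arbitrary, while the
    selection of a subsequence asks for a Lipschitz bound on the whole line; \<open>max 0 t\<close>
    freezes them at time 0.\<close>
  define f where "f k t = (x k (max 0 t), B k (max 0 t))" for k t
  have R0: "0 \<le> R" using order_trans[OF norm_ge_zero R[of 0]] by simp
  have mono: "norm (f k v - f k u) \<le> (C * R + C) * (v - u)" if "u \<le> v" for k u v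
  proof -
    have "norm (f k v - f k u) \<le> norm (x k (max 0 v) - x k (max 0 u)) + norm (B k (max 0 v) - B k (max 0 u))"
      by (simp add: f_def norm_Pair_le)
    also have "norm (x k (max 0 v) - x k (max 0 u)) \<le> C * R * (max 0 v - max 0 u)"
      by (rule solves_lipschitz[OF A C(3) C0, where R = R and T = "max 0 v"]) (use R that in auto)
    also have "norm (B k (max 0 v) - B k (max 0 u)) \<le> C * (max 0 v - max 0 u)"
      by (rule law_primitive_norm_le[OF B C(2)]) (use that in auto)
    also have "C * R * (max 0 v - max 0 u) + C * (max 0 v - max 0 u) = (C * R + C) * (max 0 v - max 0 u)"
      by (simp add: algebra_simps)
    also have "\<dots> \<le> (C * R + C) * (v - u)" using that C0 R0 by (intro mult_left_mono) auto
    finally show ?thesis by simp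
  qed
  have "norm (f k v - f k u) \<le> (C * R + C) * \<bar>v - u\<bar>" for k u v
    using mono[of u v k] mono[of v u k] by (cases "u \<le> v") (auto simp: norm_minus_commute)
  moreover have "norm (f k 0) \<le> R" for k
    using R[of 0 k] by (simp add: f_def B_def norm_Pair)
  ultimately obtain r g where r: "strict_mono r" and g: "\<And>t. (\<lambda>k. f (r k) t) \<longlonglongrightarrow> g t"
    using lipschitz_pointwise_convergent_subseq by metis
  have gx: "(\<lambda>k. x (r k) t) \<longlonglongrightarrow> fst (g t)" and gB: "(\<lambda>k. B (r k) t) \<longlonglongrightarrow> snd (g t)" if "t \<ge> 0" for t
    using tendsto_fst[OF g[of t]] tendsto_snd[OF g[of t]] that by (simp_all add: f_def)
  have "trajectory M (\<lambda>t. fst (g t))"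
  proof (rule driven_imp_trajectory[OF M(1)])
    show "law_primitive M (\<lambda>t. snd (g t))"
      unfolding law_primitive_def
    proof (intro allI impI)
      fix u v :: real assume uv: "0 \<le> u \<and> u < v"
      have "(\<lambda>k. (1 / (v - u)) *\<^sub>R (B (r k) v - B (r k) u)) \<longlonglongrightarrow> (1 / (v - u)) *\<^sub>R (snd (g v) - snd (g u))"
        using uv by (intro tendsto_intros gB) auto
      then show "(1 / (v - u)) *\<^sub>R (snd (g v) - snd (g u)) \<in> M"
        by (rule closed_sequentially[OF compact_imp_closed[OF M(1)], rotated])
          (use B uv in \<open>simp add: law_primitive_def\<close>)
    qed
    fix T :: real
    have "driven (\<lambda>t. snd (g t)) (C * (C * R)) T (\<lambda>t. fst (g t))"
      unfolding driven_def
    proof (intro allI impI)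
      fix u v :: real assume uv: "0 \<le> u \<and> u \<le> v \<and> v \<le> T"
      have lim: "(\<lambda>k. norm (x (r k) v - x (r k) u - (B (r k) v - B (r k) u) *v x (r k) u))
          \<longlonglongrightarrow> norm (fst (g v) - fst (g u) - (snd (g v) - snd (g u)) *v fst (g u))"
        using uv by (intro tendsto_intros gB gx
            bounded_bilinear.tendsto[OF bounded_bilinear_matrix_vector_mult]) auto
      have "driven (B k) (C * (C * R)) T (x k)" for k
        unfolding B_def by (rule solves_imp_driven[OF bM A C(3) C0]) (use R in auto)
      with uv show "norm (fst (g v) - fst (g u) - (snd (g v) - snd (g u)) *v fst (g u)) \<le> C * (C * R) * (v - u)\<^sup>2"
        by (intro LIMSEQ_le_const2[OF lim]) (auto simp: driven_def)
    qed
    then show "\<exists>K. driven (\<lambda>t. snd (g t)) K T (\<lambda>t. fst (g t))" ..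
  qed
  from r this gx show thesis by (rule that)
qed

section \<open>Existence of solutions for a given switching law, and superposition\<close>

lemma switching_law_mult_integrable:
  fixes A :: "real \<Rightarrow> real^'n^'n"
  assumes M: "bounded M" and A: "switching_law M A" and p: "continuous_on {0..T} p"
    and uv: "0 \<le> u" "v \<le> T"
  shows "(\<lambda>s. A s *v p s) integrable_on {u..v}"
proof -
  obtain C where C: "C > 0" "\<And>X y. X \<in> M \<Longrightarrow> norm (X *v y) \<le> C * norm y"
    using bounded_matrices_uniform_bound[OF M] by metis
  have sub: "{u..v} \<subseteq> {0..T}" using uv by auto
  have p': "continuous_on {u..v} p" using p sub by (rule continuous_on_subset)
  obtain b where b: "\<And>s. s \<in> {u..v} \<Longrightarrow> norm (p s) \<le> b"
    using compact_imp_bounded[OF compact_continuous_image[OF p' compact_Icc]] by (meson bounded_iff imageI)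
  have "(\<lambda>s. A s *v p s) absolutely_integrable_on {u..v}"
  proof (rule measurable_bounded_by_integrable_imp_absolutely_integrable)
    have "{u..v} \<subseteq> {0..}" using uv by auto
    then have Am: "A \<in> borel_measurable (lebesgue_on {u..v})"
      using A unfolding switching_law_def by (meson measurable_restrict_mono)
    have pm: "p \<in> borel_measurable (lebesgue_on {u..v})"
      using p' by (rule continuous_imp_measurable_on_sets_lebesgue) simp
    have "continuous_on UNIV (\<lambda>q :: (real^'n^'n) \<times> (real^'n). fst q *v snd q)"
      by (intro bounded_bilinear.continuous_on[OF bounded_bilinear_matrix_vector_mult] continuous_intros)
    then show "(\<lambda>s. A s *v p s) \<in> borel_measurable (lebesgue_on {u..v})"
      by (rule borel_measurable_continuous_Pair[OF Am pm])
    show "(\<lambda>_. C * b) integrable_on {u..v}" by (rule integrable_const_ivl)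
    fix s assume s: "s \<in> {u..v}"
    have "norm (A s *v p s) \<le> C * norm (p s)"
      using A s uv by (intro C) (auto simp: switching_law_def)
    also have "\<dots> \<le> C * b" using b[OF s] C(1) by simp
    finally show "norm (A s *v p s) \<le> C * b" .
  qed simp
  then show ?thesis by (rule absolutely_integrable_on_def[THEN iffD1, THEN conjunct1])
qed

text \<open>The terms of the Peano-Baker series: the differences of consecutive Picard iterates,
  whose partial sums are the iterates.\<close>

primrec picard_term :: "(real \<Rightarrow> real^'n^'n) \<Rightarrow> real^'n \<Rightarrow> nat \<Rightarrow> real \<Rightarrow> real^'n" where
  "picard_term A y 0 = (\<lambda>t. y)"
| "picard_term A y (Suc k) = (\<lambda>t. integral {0..t} (\<lambda>s. A s *v picard_term A y k s))"

lemma continuous_on_picard_term: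
  assumes M: "bounded M" and A: "switching_law M A"
  shows "continuous_on {0..T} (picard_term A y k)"
proof (induction k)
  case (Suc k)
  then show ?case
    using switching_law_mult_integrable[OF M A Suc, of 0 T]
    by (simp add: indefinite_integral_continuous_1)
qed simp

text \<open>The weight \<open>exp (2 * C * t)\<close> makes each Picard step halve the bound.\<close>

lemma norm_picard_term_le:
  assumes M: "bounded M" and A: "switching_law M A"
    and C: "C > 0" "\<And>X y. X \<in> M \<Longrightarrow> norm (X *v y) \<le> C * norm y" and t: "t \<ge> 0"
  shows "norm (picard_term A y k t) \<le> norm y * (1 / 2) ^ k * exp (2 * C * t)"
  using t
proof (induction k arbitrary: t)
  case 0
  have "norm y * 1 \<le> norm y * exp (2 * C * t)" using 0 C(1) by (intro mult_left_mono) auto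
  then show ?case by simp
next
  case (Suc k)
  \<comment> \<open>A primitive of the integrand below: differentiating the exponential yields
    \<open>2 * C\<close>, and the 2 cancels one factor \<open>1 / 2\<close>.\<close>
  define G where "G s = norm y * (1 / 2) ^ Suc k * exp (2 * C * s)" for s
  have G: "((\<lambda>s. C * (norm y * (1 / 2) ^ k * exp (2 * C * s))) has_integral (G t - G 0)) {0..t}"
    by (rule fundamental_theorem_of_calculus[OF Suc.prems])
      (auto simp: G_def has_real_derivative_iff_has_vector_derivative[symmetric]
        intro!: derivative_eq_intros)
  have "norm (integral {0..t} (\<lambda>s. A s *v picard_term A y k s)) \<le> integral {0..t} (\<lambda>s. C * (norm y * (1 / 2) ^ k * exp (2 * C * s)))"
  proof (rule integral_norm_bound_integral)
    show "(\<lambda>s. A s *v picard_term A y k s) integrable_on {0..t}"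
      by (rule switching_law_mult_integrable[OF M A continuous_on_picard_term[OF M A]]) auto
    show "(\<lambda>s. C * (norm y * (1 / 2) ^ k * exp (2 * C * s))) integrable_on {0..t}"
      using G by (rule has_integral_integrable)
    fix s assume s: "s \<in> {0..t}"
    have "norm (A s *v picard_term A y k s) \<le> C * norm (picard_term A y k s)"
      using A s by (intro C) (simp add: switching_law_def)
    also have "\<dots> \<le> C * (norm y * (1 / 2) ^ k * exp (2 * C * s))"
      using Suc.IH[of s] s C(1) by (intro mult_left_mono) auto
    finally show "norm (A s *v picard_term A y k s) \<le> C * (norm y * (1 / 2) ^ k * exp (2 * C * s))" .
  qed
  also have "\<dots> = G t - G 0" using G by (rule integral_unique)
  also have "\<dots> \<le> G t" by (simp add: G_def)
  finally show ?case by (simp add: G_def)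
qed

text \<open>The terms of the series have a geometric majorant on each \<open>{0..T}\<close>, so it
  converges uniformly there, and uniform convergence permits the passage to the limit in the
  integral equation for the partial sums.\<close>

lemma solution_exists:
  fixes A :: "real \<Rightarrow> real^'n^'n"
  assumes M: "bounded M" and A: "switching_law M A"
  obtains x where "solves A x" "x 0 = y"
proof -
  obtain C where C: "C > 0" "\<And>X y. X \<in> M \<Longrightarrow> norm (X *v y) \<le> C * norm y"
    using bounded_matrices_uniform_bound[OF M] by metis
  define P where "P = picard_term A y"
  define S where "S n t = (\<Sum>k<n. P k t)" for n t
  define x where "x t = (\<Sum>k. P k t)" for t
  have contP: "continuous_on {0..T} (P k)" for k T
    unfolding P_def by (rule continuous_on_picard_term[OF M A])
  have unif: "uniform_limit {0..T} S x sequentially" for T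
    unfolding S_def[abs_def] x_def[abs_def]
  proof (rule Weierstrass_m_test)
    fix k t assume t: "t \<in> {0..T}"
    have "norm (P k t) \<le> norm y * (1 / 2) ^ k * exp (2 * C * t)"
      unfolding P_def using t by (intro norm_picard_term_le[OF M A C]) auto
    also have "\<dots> \<le> norm y * (1 / 2) ^ k * exp (2 * C * T)"
      using t C(1) by (intro mult_left_mono) auto
    finally show "norm (P k t) \<le> norm y * exp (2 * C * T) * (1 / 2) ^ k" by (simp add: mult_ac)
  qed (intro summable_mult summable_geometric, simp)
  have contS: "continuous_on {0..T} (S n)" for n T
    unfolding S_def[abs_def] by (intro continuous_intros contP)
  have contx: "continuous_on {0..T} x" for T
    by (rule uniform_limit_theorem[OF _ unif]) (use contS in auto)
  note int = switching_law_mult_integrable[OF M A]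
  have step: "S (Suc n) t = y + integral {0..t} (\<lambda>s. A s *v S n s)" if t: "t \<ge> 0" for n t
  proof -
    have "(\<lambda>s. A s *v P k s) integrable_on {0..t}" for k
      by (rule int[OF contP[of t]]) simp_all
    then have "integral {0..t} (\<lambda>s. A s *v S n s) = (\<Sum>k<n. integral {0..t} (\<lambda>s. A s *v P k s))"
      by (simp add: S_def linear_sum[OF matrix_vector_mul_linear] integral_sum)
    moreover have "S (Suc n) t = y + (\<Sum>k<n. P (Suc k) t)"
      unfolding S_def sum.lessThan_Suc_shift by (simp add: P_def)
    ultimately show ?thesis by (simp add: P_def)
  qed
  have eq: "x t = y + integral {0..t} (\<lambda>s. A s *v x s)" if t: "t \<ge> 0" for t
  proof (rule LIMSEQ_unique)
    have "(\<lambda>n. S n t) \<longlonglongrightarrow> x t"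
      using tendsto_uniform_limitI[OF unif[of t]] t by simp
    then show "(\<lambda>n. S (Suc n) t) \<longlonglongrightarrow> x t" by (rule LIMSEQ_Suc)
    have "(\<lambda>n. integral {0..t} (\<lambda>s. A s *v S n s)) \<longlonglongrightarrow> integral {0..t} (\<lambda>s. A s *v x s)"
    proof (rule tendstoI)
      fix e :: real assume "e > 0"
      \<comment> \<open>An error \<open>d\<close> in the integrand's state variable grows to at most
        \<open>C * t * d\<close>; the \<open>+ 1\<close> covers \<open>t = 0\<close>, and the 2
        makes the final inequality strict.\<close>
      define d where "d = e / (2 * (C * t + 1))"
      have Ct: "0 \<le> C * t" using C(1) t by simp
      then have d: "d > 0" using \<open>e > 0\<close> by (simp add: d_def add_nonneg_pos)
      have "\<forall>\<^sub>F n in sequentially. \<forall>s\<in>{0..t}. dist (S n s) (x s) < d"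
        using uniform_limitD[OF unif d] .
      then show "\<forall>\<^sub>F n in sequentially. dist (integral {0..t} (\<lambda>s. A s *v S n s)) (integral {0..t} (\<lambda>s. A s *v x s)) < e"
      proof eventually_elim
        case (elim n)
        have i1: "(\<lambda>s. A s *v S n s) integrable_on {0..t}" and i2: "(\<lambda>s. A s *v x s) integrable_on {0..t}"
          by (rule int[OF contS[of t]] int[OF contx[of t]]; simp)+
        have "norm (integral {0..t} (\<lambda>s. A s *v S n s) - integral {0..t} (\<lambda>s. A s *v x s))
            = norm (integral {0..t} (\<lambda>s. A s *v (S n s - x s)))"
          using i1 i2 by (simp add: matrix_vector_mult_diff_distrib integral_diff)
        also have "\<dots> \<le> integral {0..t} (\<lambda>s. C * d)"
        proof (rule integral_norm_bound_integral)
          show "(\<lambda>s. A s *v (S n s - x s)) integrable_on {0..t}"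
            using i1 i2 by (simp add: matrix_vector_mult_diff_distrib integrable_diff)
          fix s assume s: "s \<in> {0..t}"
          have "norm (A s *v (S n s - x s)) \<le> C * norm (S n s - x s)"
            using A s by (intro C) (simp add: switching_law_def)
          also have "\<dots> \<le> C * d" using elim s C(1) by (intro mult_left_mono) (auto simp: dist_norm less_imp_le)
          finally show "norm (A s *v (S n s - x s)) \<le> C * d" .
        qed (rule integrable_const_ivl)
        also have "\<dots> = C * t * d" using t by simp
        also have "\<dots> \<le> (C * t + 1) * d" using d by (intro mult_right_mono) auto
        also have "\<dots> = e / 2" using Ct by (simp add: d_def field_simps)
        also have "\<dots> < e" using \<open>e > 0\<close> by simp
        finally show ?case by (simp add: dist_norm)
      qed
    qed
    then show "(\<lambda>n. S (Suc n) t) \<longlonglongrightarrow> y + integral {0..t} (\<lambda>s. A s *v x s)"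
      unfolding step[OF t] by (intro tendsto_intros)
  qed
  have "solves A x"
    unfolding solves_def
  proof (intro allI impI)
    fix u v :: real assume uv: "0 \<le> u \<and> u \<le> v"
    have i: "(\<lambda>s. A s *v x s) integrable_on {a..b}" if "0 \<le> a" for a b
      by (rule int[OF contx[of b] that]) simp
    have "integral {0..u} (\<lambda>s. A s *v x s) + integral {u..v} (\<lambda>s. A s *v x s) = integral {0..v} (\<lambda>s. A s *v x s)"
      using uv i[of 0 v] by (intro Henstock_Kurzweil_Integration.integral_combine) auto
    with eq[of u] eq[of v] uv have "x v - x u = integral {u..v} (\<lambda>s. A s *v x s)"
      by (simp add: algebra_simps)
    then show "((\<lambda>s. A s *v x s) has_integral (x v - x u)) {u..v}"
      using integrable_integral[OF i[of u v]] uv by simp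
  qed
  moreover have "x 0 = y" using eq[of 0] by simp
  ultimately show thesis by (rule that)
qed

text \<open>The law of \<open>x\<close> is kept: a solution from \<open>y\<close> under this law is
  subtracted from \<open>x\<close>, and linearity makes the difference a solution from
  \<open>z\<close>. This is the source of the triangle inequality for \<open>v\<close>.\<close>

lemma trajectory_split:
  assumes M: "compact M" "convex M" and x: "trajectory M x" "x 0 = y + z"
  obtains p q where "trajectory M p" "trajectory M q" "p 0 = y" "q 0 = z" "\<And>t. x t = p t + q t"
proof -
  obtain A where A: "switching_law M A" "solves A x" using x(1) by (rule trajectory_imp_solves)
  obtain p where p: "solves A p" "p 0 = y" using solution_exists[OF compact_imp_bounded[OF M(1)] A(1)] .
  define q where "q t = x t - p t" for t
  have "solves A q"
    unfolding solves_def
  proof (intro allI impI)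
    fix u v :: real assume "0 \<le> u \<and> u \<le> v"
    then have "((\<lambda>s. A s *v x s - A s *v p s) has_integral ((x v - x u) - (p v - p u))) {u..v}"
      using A(2) p(1) by (intro has_integral_diff) (auto simp: solves_def)
    then show "((\<lambda>s. A s *v q s) has_integral (q v - q u)) {u..v}"
      by (simp add: q_def matrix_vector_mult_diff_distrib algebra_simps)
  qed
  then show thesis
    using solves_imp_trajectory[OF M A(1)] p x(2) by (intro that[of p q]) (auto simp: q_def)
qed

section \<open>Barabanov norms\<close>

lemma is_norm_zero: "is_norm w \<Longrightarrow> w 0 = 0"
  by (simp add: is_norm_def)

lemma is_norm_pos: "is_norm w \<Longrightarrow> y \<noteq> 0 \<Longrightarrow> 0 < w y"
  unfolding is_norm_def by (metis order_le_less)

lemma is_norm_scaleR: "is_norm w \<Longrightarrow> w (c *\<^sub>R y) = \<bar>c\<bar> * w y"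
  by (simp add: is_norm_def)

lemma is_norm_upper_bound:
  fixes w :: "'a::euclidean_space \<Rightarrow> real"
  assumes w: "is_norm w"
  obtains C where "C > 0" "\<And>y. w y \<le> C * norm y"
proof (rule that[of "1 + (\<Sum>i\<in>Basis. w i)"])
  have nn: "0 \<le> w y" and tri: "w (y + z) \<le> w y + w z" and hom: "w (c *\<^sub>R y) = \<bar>c\<bar> * w y"
    and zero: "w 0 = 0" for y z c
    using w by (auto simp: is_norm_def)
  show "1 + (\<Sum>i\<in>Basis. w i) > 0" by (simp add: add_pos_nonneg sum_nonneg nn)
  fix y
  have "w (\<Sum>i\<in>S. (y \<bullet> i) *\<^sub>R i) \<le> (\<Sum>i\<in>S. \<bar>y \<bullet> i\<bar> * w i)" if "finite S" for S
    using that
  proof (induction S)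
    case (insert i S)
    then show ?case
      using tri[of "(y \<bullet> i) *\<^sub>R i" "\<Sum>i\<in>S. (y \<bullet> i) *\<^sub>R i"] by (simp add: hom)
  qed (simp add: zero)
  from this[OF finite_Basis] have "w y \<le> (\<Sum>i\<in>Basis. \<bar>y \<bullet> i\<bar> * w i)"
    by (simp add: euclidean_representation)
  also have "\<dots> \<le> (\<Sum>i\<in>Basis. norm y * w i)"
    by (intro sum_mono mult_right_mono nn Basis_le_norm)
  also have "\<dots> \<le> (1 + (\<Sum>i\<in>Basis. w i)) * norm y"
    by (simp add: sum_distrib_left[symmetric] algebra_simps)
  finally show "w y \<le> (1 + (\<Sum>i\<in>Basis. w i)) * norm y" .
qed

lemma is_norm_continuous:
  fixes w :: "'a::euclidean_space \<Rightarrow> real"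
  assumes w: "is_norm w"
  shows "continuous_on UNIV w"
proof -
  obtain C where C: "C > 0" "\<And>y. w y \<le> C * norm y" using is_norm_upper_bound[OF w] by blast
  have tri: "w y \<le> w z + w (y - z)" for y z
  proof -
    have "w (z + (y - z)) \<le> w z + w (y - z)" using w unfolding is_norm_def by blast
    then show ?thesis by simp
  qed
  have "\<bar>w y - w z\<bar> \<le> C * norm (y - z)" for y z
    using tri[of y z] tri[of z y] C(2)[of "y - z"] C(2)[of "z - y"] by (simp add: norm_minus_commute)
  then show ?thesis
    using C(1) by (intro lipschitz_on_continuous_on[of C]) (auto simp: lipschitz_on_def dist_norm)
qed

lemma is_norm_lower_bound:
  fixes w :: "'a::euclidean_space \<Rightarrow> real"
  assumes w: "is_norm w"
  obtains c where "c > 0" "\<And>y. c * norm y \<le> w y"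
proof -
  have "sphere (0::'a) 1 \<noteq> {}" using nonempty_Basis by force
  then obtain y0 where y0: "y0 \<in> sphere 0 1" "\<And>y. y \<in> sphere 0 1 \<Longrightarrow> w y0 \<le> w y"
    using continuous_attains_inf[OF compact_sphere _ continuous_on_subset[OF is_norm_continuous[OF w] subset_UNIV]]
    by blast
  show thesis
  proof (rule that[of "w y0"])
    show "w y0 > 0" using y0(1) by (intro is_norm_pos[OF w]) auto
    show "w y0 * norm y \<le> w y" for y
    proof (cases "y = 0")
      case False
      then have "w y0 \<le> w ((1 / norm y) *\<^sub>R y)" by (intro y0) simp
      also have "\<dots> = w y / norm y" by (simp add: is_norm_scaleR[OF w])
      finally show ?thesis using False by (simp add: field_simps)
    qed (simp add: is_norm_zero[OF w])
  qed
qed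

section \<open>Omega-limit sets and continuous functions that do not increase along a curve\<close>

lemma omega_limit_le:
  assumes f: "continuous_on UNIV f" and anti: "\<And>s t. 0 \<le> s \<Longrightarrow> s \<le> t \<Longrightarrow> f (x t) \<le> (f (x s) :: real)"
    and z: "z \<in> omega_limit x" and t: "0 \<le> t"
  shows "f z \<le> f (x t)"
proof -
  obtain s where s: "filterlim s at_top sequentially" "(\<lambda>k. x (s k)) \<longlonglongrightarrow> z"
    using z by (auto simp: omega_limit_def)
  have "(\<lambda>k. f (x (s k))) \<longlonglongrightarrow> f z"
    using continuous_on_tendsto_compose[OF f s(2)] by simp
  moreover have "\<forall>\<^sub>F k in sequentially. f (x (s k)) \<le> f (x t)"
    using filterlim_at_top[THEN iffD1, OF s(1), rule_format, of t]
    by eventually_elim (use t anti in auto)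
  ultimately show ?thesis by (intro tendsto_upperbound) auto
qed

text \<open>By symmetry one inequality suffices: \<open>f z\<close> is below every value
  \<open>f (x t)\<close> with \<open>t \<ge> 0\<close>, in particular below those along a sequence
  of times that leads to \<open>z'\<close>.\<close>

lemma omega_limit_constant:
  assumes f: "continuous_on UNIV f" and anti: "\<And>s t. 0 \<le> s \<Longrightarrow> s \<le> t \<Longrightarrow> f (x t) \<le> (f (x s) :: real)"
    and z: "z \<in> omega_limit x" and z': "z' \<in> omega_limit x"
  shows "f z = f z'"
proof -
  have "f z \<le> f z'" if z: "z \<in> omega_limit x" and z': "z' \<in> omega_limit x" for z z'
  proof -
    obtain s where s: "filterlim s at_top sequentially" "(\<lambda>k. x (s k)) \<longlonglongrightarrow> z'"
      using z' by (auto simp: omega_limit_def)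
    have "(\<lambda>k. f (x (s k))) \<longlonglongrightarrow> f z'"
      using continuous_on_tendsto_compose[OF f s(2)] by simp
    moreover have "\<forall>\<^sub>F k in sequentially. f z \<le> f (x (s k))"
      using filterlim_at_top[THEN iffD1, OF s(1), rule_format, of 0]
      by eventually_elim (rule omega_limit_le[OF f anti z])
    ultimately show ?thesis by (intro tendsto_lowerbound) auto
  qed
  with z z' show ?thesis by (meson order_antisym)
qed

lemma omega_limit_eq:
  assumes f: "continuous_on UNIV f" and const: "\<And>t. 0 \<le> t \<Longrightarrow> f (x t) = (c :: real)"
    and z: "z \<in> omega_limit x"
  shows "f z = c"
proof -
  obtain s where s: "filterlim s at_top sequentially" "(\<lambda>k. x (s k)) \<longlonglongrightarrow> z"
    using z by (auto simp: omega_limit_def)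
  have "(\<lambda>k. f (x (s k))) \<longlonglongrightarrow> f z"
    using continuous_on_tendsto_compose[OF f s(2)] by simp
  moreover have "\<forall>\<^sub>F k in sequentially. f (x (s k)) = c"
    using filterlim_at_top[THEN iffD1, OF s(1), rule_format, of 0]
    by eventually_elim (rule const)
  ultimately show ?thesis by (rule LIMSEQ_unique[OF _ tendsto_eventually])
qed

lemma omega_limit_nonempty:
  fixes x :: "real \<Rightarrow> 'a::euclidean_space"
  assumes "\<And>t. 0 \<le> t \<Longrightarrow> norm (x t) \<le> R"
  obtains z where "z \<in> omega_limit x"
proof -
  have "bounded (range (\<lambda>k. x (real k)))" unfolding bounded_iff using assms by (intro exI[of _ R]) auto
  then obtain z r where r: "strict_mono (r :: nat \<Rightarrow> nat)" "((\<lambda>k. x (real k)) \<circ> r) \<longlonglongrightarrow> z"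
    using bounded_imp_convergent_subsequence by blast
  have "filterlim (\<lambda>k. real (r k)) at_top sequentially"
    using r(1) by (intro filterlim_compose[OF filterlim_real_sequentially] filterlim_subseq)
  then have "z \<in> omega_limit x" using r(2) unfolding omega_limit_def o_def by blast
  then show thesis by (rule that)
qed

lemma eventually_shift_at_top: "(\<forall>\<^sub>F t in at_top. P (s + t :: real)) \<Longrightarrow> (\<forall>\<^sub>F t in at_top. P t)"
  unfolding eventually_at_top_linorder
proof (elim exE)
  fix N assume N: "\<forall>t\<ge>N. P (s + t)"
  have "P t" if "t \<ge> s + N" for t
    using N[rule_format, of "t - s"] that by simp
  then show "\<exists>N. \<forall>t\<ge>N. P t" by blast
qed

section \<open>Consequences of the existence of one Barabanov norm\<close>

locale barabanov_system =
  fixes M :: "(real^'n^'n) set" and w :: "real^'n \<Rightarrow> real"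
  assumes compact: "compact M" and convex: "convex M" and barabanov: "barabanov_norm M w"
begin

lemma is_norm: "is_norm w"
  and decreasing: "trajectory M x \<Longrightarrow> 0 \<le> t \<Longrightarrow> w (x t) \<le> w (x 0)"
  and extremal_exists: "\<exists>x. trajectory M x \<and> x 0 = y \<and> (\<forall>t\<ge>0. w (x t) = w y)"
  using barabanov by (auto simp: barabanov_norm_def)

lemma antimono:
  assumes "trajectory M x" "0 \<le> s" "s \<le> t"
  shows "w (x t) \<le> w (x s)"
  using decreasing[OF trajectory_shift[OF compact convex assms(1,2)], of "t - s"] assms(3) by simp

lemma omega_limit_const:
  assumes "trajectory M x" "z \<in> omega_limit x" "z' \<in> omega_limit x"
  shows "w z = w z'"
  by (rule omega_limit_constant[OF is_norm_continuous[OF is_norm] _ assms(2,3)]) (rule antimono[OF assms(1)])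

lemma omega_limit_upper:
  assumes "trajectory M x" "z \<in> omega_limit x"
  shows "w z \<le> w (x 0)"
  by (rule omega_limit_le[OF is_norm_continuous[OF is_norm] _ assms(2)]) (simp_all add: antimono[OF assms(1)])

lemma trajectory_norm_le:
  obtains R where "R \<ge> 0" "\<And>x t. trajectory M x \<Longrightarrow> 0 \<le> t \<Longrightarrow> norm (x t) \<le> R * norm (x 0)"
proof -
  obtain C where C: "C > 0" "\<And>y. w y \<le> C * norm y" using is_norm_upper_bound[OF is_norm] by blast
  obtain c where c: "c > 0" "\<And>y. c * norm y \<le> w y" using is_norm_lower_bound[OF is_norm] by blast
  show thesis
  proof (rule that[of "C / c"])
    show "norm (x t) \<le> C / c * norm (x 0)" if "trajectory M x" "0 \<le> t" for x t
    proof -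
      have "c * norm (x t) \<le> C * norm (x 0)"
        using c(2)[of "x t"] decreasing[OF that] C(2)[of "x 0"] by linarith
      then show ?thesis using c(1) by (simp add: field_simps)
    qed
  qed (use C c in simp)
qed

section \<open>The limsup function as a norm, and its extremal trajectories\<close>

abbreviation v where "v \<equiv> limsup_norm M"

text \<open>The supremum is over a nonempty set, since \<open>extremal_exists\<close> supplies a
  trajectory from \<open>y\<close>, and it lies between 0 and \<open>R * norm y\<close>; hence the
  conversion to a real number is exact.\<close>

lemma v_ereal: "ereal (v y) = (SUP x \<in> {x. trajectory M x \<and> x 0 = y}. Limsup at_top (\<lambda>t. ereal (norm (x t))))"
  (is "_ = ?V")
proof -
  obtain R where R: "R \<ge> 0" "\<And>x t. trajectory M x \<Longrightarrow> 0 \<le> t \<Longrightarrow> norm (x t) \<le> R * norm (x 0)"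
    using trajectory_norm_le by blast
  have "?V \<le> ereal (R * norm y)"
  proof (rule SUP_least)
    fix x assume "x \<in> {x. trajectory M x \<and> x 0 = y}"
    then have "\<forall>\<^sub>F t in at_top. ereal (norm (x t)) \<le> ereal (R * norm y)"
      using R(2) by (intro eventually_at_top_linorderI[of 0]) auto
    then show "Limsup at_top (\<lambda>t. ereal (norm (x t))) \<le> ereal (R * norm y)" by (rule Limsup_bounded)
  qed
  moreover have "0 \<le> ?V"
  proof -
    obtain x where x: "x \<in> {x. trajectory M x \<and> x 0 = y}" using extremal_exists by blast
    have "0 \<le> Limsup at_top (\<lambda>t. ereal (norm (x t)))"
      by (rule le_Limsup) (auto intro: trivial_limit_at_top_linorder)
    also have "\<dots> \<le> ?V" using x by (rule SUP_upper)
    finally show ?thesis .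
  qed
  ultimately have "\<bar>?V\<bar> \<noteq> \<infinity>" by auto
  then show ?thesis by (simp add: limsup_norm_def ereal_real')
qed

text \<open>Replaces supremum and upper limit by a statement on real numbers and large times, from
  which the properties of \<open>v\<close> are derived. The slack \<open>e\<close> is there because
  an upper limit at most \<open>b\<close> does not bring the values themselves eventually below
  \<open>b\<close>.\<close>

lemma v_le_iff:
  "v y \<le> b \<longleftrightarrow> (\<forall>x. trajectory M x \<longrightarrow> x 0 = y \<longrightarrow> (\<forall>e>0. \<forall>\<^sub>F t in at_top. norm (x t) \<le> b + e))"
proof -
  have "Limsup at_top (\<lambda>t. ereal (norm (x t))) \<le> ereal b \<longleftrightarrow> (\<forall>e>0. \<forall>\<^sub>F t in at_top. norm (x t) \<le> b + e)"
    (is "?L \<le> _ \<longleftrightarrow> ?R") for x :: "real \<Rightarrow> real^'n"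
  proof
    assume le: "?L \<le> ereal b"
    show ?R
    proof (intro allI impI)
      fix e :: real assume "e > 0"
      then have "ereal b < ereal (b + e)" by simp
      then have "\<forall>\<^sub>F t in at_top. ereal (norm (x t)) < ereal (b + e)"
        using le Limsup_le_iff by metis
      then show "\<forall>\<^sub>F t in at_top. norm (x t) \<le> b + e" by eventually_elim simp
    qed
  next
    assume ?R
    show "?L \<le> ereal b"
    proof (rule ereal_le_epsilon2)
      fix e :: real assume "e > 0"
      then have "\<forall>\<^sub>F t in at_top. ereal (norm (x t)) \<le> ereal b + ereal e"
        using \<open>?R\<close> by simp
      then show "?L \<le> ereal b + ereal e" by (rule Limsup_bounded)
    qed
  qed
  then show ?thesis
    unfolding ereal_less_eq(3)[symmetric, of "v y"] v_ereal SUP_le_iff by auto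
qed

lemma v_eventually:
  assumes "trajectory M x" "e > 0"
  shows "\<forall>\<^sub>F t in at_top. norm (x t) \<le> v (x 0) + e"
  using order_refl[of "v (x 0)"] assms unfolding v_le_iff by blast

lemma v_norm_le:
  obtains R where "R \<ge> 0" "\<And>y. v y \<le> R * norm y"
proof -
  obtain R where R: "R \<ge> 0" "\<And>x t. trajectory M x \<Longrightarrow> 0 \<le> t \<Longrightarrow> norm (x t) \<le> R * norm (x 0)"
    using trajectory_norm_le by blast
  have "v y \<le> R * norm y" for y
    unfolding v_le_iff
  proof (intro allI impI)
    fix x :: "real \<Rightarrow> real^'n" and e :: real
    assume x: "trajectory M x" "x 0 = y" "e > 0"
    show "\<forall>\<^sub>F t in at_top. norm (x t) \<le> R * norm y + e"
      using eventually_ge_at_top[of 0]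
    proof eventually_elim
      case (elim t)
      then show ?case using R(2)[OF x(1) elim] x by simp
    qed
  qed
  with R(1) show thesis by (rule that)
qed

lemma v_pos:
  assumes "y \<noteq> 0"
  shows "0 < v y"
proof (rule ccontr)
  assume "\<not> 0 < v y"
  then have v: "v y \<le> 0" by simp
  obtain C where C: "C > 0" "\<And>y. w y \<le> C * norm y" using is_norm_upper_bound[OF is_norm] by blast
  obtain x where x: "trajectory M x" "x 0 = y" "\<And>t. t \<ge> 0 \<Longrightarrow> w (x t) = w y"
    using extremal_exists by blast
  have wy: "w y > 0" using assms by (rule is_norm_pos[OF is_norm])
  \<comment> \<open>Along \<open>x\<close> the value of \<open>w\<close> stays at
    \<open>w y\<close>, so the Euclidean norm never falls below \<open>w y / C\<close>; half of that
    is incompatible with \<open>v y \<le> 0\<close>.\<close>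
  define e where "e = w y / (2 * C)"
  have "e > 0" using wy C(1) by (simp add: e_def)
  with v x(1,2) have "\<forall>\<^sub>F t in at_top. norm (x t) \<le> 0 + e" unfolding v_le_iff by blast
  from eventually_happens[OF eventually_conj[OF this eventually_ge_at_top[of 0]]]
  obtain t where t: "norm (x t) \<le> e" "t \<ge> 0" by auto
  have "w y \<le> C * norm (x t)" using C(2)[of "x t"] x(3)[OF t(2)] by simp
  also have "\<dots> \<le> C * e" using t C(1) by simp
  also have "\<dots> = w y / 2" using C(1) by (simp add: e_def)
  finally show False using wy by simp
qed

lemma v_scaleR_le: "v (c *\<^sub>R y) \<le> \<bar>c\<bar> * v y"
proof (cases "c = 0")
  case True
  obtain R where "R \<ge> 0" "\<And>y. v y \<le> R * norm y" using v_norm_le by blast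
  from this(2)[of 0] True show ?thesis by simp
next
  case False
  show ?thesis
    unfolding v_le_iff[of "c *\<^sub>R y"]
  proof (intro allI impI)
    fix x :: "real \<Rightarrow> real^'n" and e :: real
    assume x: "trajectory M x" "x 0 = c *\<^sub>R y" "e > 0"
    have "\<forall>\<^sub>F t in at_top. norm ((1 / c) *\<^sub>R x t) \<le> v y + e / \<bar>c\<bar>"
      using v_eventually[OF trajectory_scaleR[OF compact convex x(1)], of "e / \<bar>c\<bar>" "1 / c"] x False by simp
    then show "\<forall>\<^sub>F t in at_top. norm (x t) \<le> \<bar>c\<bar> * v y + e"
      by eventually_elim (use False in \<open>simp add: field_simps\<close>)
  qed
qed

lemma v_scaleR: "v (c *\<^sub>R y) = \<bar>c\<bar> * v y"
proof (cases "c = 0")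
  case True
  \<comment> \<open>This yields \<open>0 \<le> v 0\<close>; the opposite bound is
    \<open>v_scaleR_le\<close> with factor 0.\<close>
  have "v 0 \<le> 2 * v 0" using v_scaleR_le[of 2 0] by simp
  with True v_scaleR_le[of 0 y] show ?thesis by simp
next
  case False
  have "v y \<le> \<bar>1 / c\<bar> * v (c *\<^sub>R y)" using v_scaleR_le[of "1 / c" "c *\<^sub>R y"] False by simp
  then have "\<bar>c\<bar> * v y \<le> v (c *\<^sub>R y)" using False by (simp add: field_simps)
  with v_scaleR_le[of c y] show ?thesis by simp
qed

lemma v_triangle: "v (y + z) \<le> v y + v z"
  unfolding v_le_iff[of "y + z"]
proof (intro allI impI)
  fix x :: "real \<Rightarrow> real^'n" and e :: real
  assume x: "trajectory M x" "x 0 = y + z" "e > 0"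
  obtain p q where pq: "trajectory M p" "trajectory M q" "p 0 = y" "q 0 = z" "\<And>t. x t = p t + q t"
    using trajectory_split[OF compact convex x(1,2)] by blast
  have e: "e / 2 > 0" using x(3) by simp
  have "\<forall>\<^sub>F t in at_top. norm (p t) \<le> v y + e / 2"
    using v_eventually[OF pq(1) e] pq(3) by simp
  moreover have "\<forall>\<^sub>F t in at_top. norm (q t) \<le> v z + e / 2"
    using v_eventually[OF pq(2) e] pq(4) by simp
  ultimately show "\<forall>\<^sub>F t in at_top. norm (x t) \<le> v y + v z + e"
  proof eventually_elim
    case (elim t)
    then show ?case using norm_triangle_ineq[of "p t" "q t"] by (simp add: pq(5))
  qed
qed

lemma is_norm_v: "is_norm v"
proof -
  have "v 0 = 0" using v_scaleR[of 0 0] by simp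
  then show ?thesis
    using v_pos v_scaleR v_triangle unfolding is_norm_def by (metis less_irrefl order_le_less)
qed

text \<open>Every continuation of \<open>x\<close> from time \<open>s\<close>, glued to
  \<open>x\<close>, competes in the supremum that defines \<open>v (x 0)\<close>, and the upper
  limit does not see the initial piece.\<close>

lemma v_decreasing:
  assumes x: "trajectory M x" and s: "0 \<le> s"
  shows "v (x s) \<le> v (x 0)"
  unfolding v_le_iff[of "x s"]
proof (intro allI impI)
  fix z :: "real \<Rightarrow> real^'n" and e :: real
  assume z: "trajectory M z" "z 0 = x s" "e > 0"
  have "\<forall>\<^sub>F t in at_top. norm (if t \<le> s then x t else z (t - s)) \<le> v (x 0) + e"
    using v_eventually[OF trajectory_concat[OF compact convex x z(1) s z(2)] z(3)] s by simp
  from eventually_conj[OF this eventually_gt_at_top[of s]]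
  have "\<forall>\<^sub>F t in at_top. norm (z (- s + t)) \<le> v (x 0) + e"
    by eventually_elim (auto split: if_splits)
  then show "\<forall>\<^sub>F t in at_top. norm (z t) \<le> v (x 0) + e"
    by (rule eventually_shift_at_top)
qed

text \<open>One half of a dynamic programming principle: the upper limit forgets what happens before
  \<open>T\<close>. Read contrapositively, it supplies trajectories along which \<open>v\<close> has
  hardly dropped at time \<open>T\<close>.\<close>

lemma v_le_from_time:
  assumes T: "0 \<le> T" and le: "\<And>x. trajectory M x \<Longrightarrow> x 0 = y \<Longrightarrow> v (x T) \<le> b"
  shows "v y \<le> b"
  unfolding v_le_iff[of y]
proof (intro allI impI)
  fix x :: "real \<Rightarrow> real^'n" and e :: real
  assume x: "trajectory M x" "x 0 = y" "e > 0"
  have "\<forall>\<^sub>F t in at_top. norm (x (T + t)) \<le> b + e"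
    using v_eventually[OF trajectory_shift[OF compact convex x(1) T] x(3)]
    by eventually_elim (use le[OF x(1,2)] in simp)
  then show "\<forall>\<^sub>F t in at_top. norm (x t) \<le> b + e"
    by (rule eventually_shift_at_top)
qed

lemma v_antimono:
  assumes "trajectory M x" "0 \<le> s" "s \<le> t"
  shows "v (x t) \<le> v (x s)"
  using v_decreasing[OF trajectory_shift[OF compact convex assms(1,2)], of "t - s"] assms(3) by simp

lemma v_omega_limit_const:
  assumes "trajectory M x" "z \<in> omega_limit x" "z' \<in> omega_limit x"
  shows "v z = v z'"
  by (rule omega_limit_constant[OF is_norm_continuous[OF is_norm_v] _ assms(2,3)]) (rule v_antimono[OF assms(1)])

lemma v_omega_limit_upper:
  assumes "trajectory M x" "z \<in> omega_limit x"
  shows "v z \<le> v (x 0)"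
  by (rule omega_limit_le[OF is_norm_continuous[OF is_norm_v] _ assms(2)]) (simp_all add: v_antimono[OF assms(1)])

text \<open>Trajectories that are almost \<open>v\<close>-optimal up to time \<open>n\<close> accumulate at a \<open>v\<close>-extremal one.\<close>

lemma v_extremal_exists:
  obtains x where "trajectory M x" "x 0 = y" "\<And>t. t \<ge> 0 \<Longrightarrow> v (x t) = v y"
proof -
  have "\<exists>x. trajectory M x \<and> x 0 = y \<and> v y - 1 / real (Suc n) < v (x (real n))" for n
  proof (rule ccontr)
    assume no: "\<not> ?thesis"
    have "v (x (real n)) \<le> v y - 1 / real (Suc n)" if "trajectory M x" "x 0 = y" for x
    proof (rule leI)
      show "\<not> v y - 1 / real (Suc n) < v (x (real n))" using no that by blast
    qed
    then have "v y \<le> v y - 1 / real (Suc n)"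
      by (rule v_le_from_time[OF of_nat_0_le_iff])
    then show False by (simp del: of_nat_Suc)
  qed
  then obtain x where x: "\<And>n. trajectory M (x n)" "\<And>n. x n 0 = y"
    "\<And>n. v y - 1 / real (Suc n) < v (x n (real n))" by metis
  obtain R where R: "\<And>x t. trajectory M x \<Longrightarrow> 0 \<le> t \<Longrightarrow> norm (x t) \<le> R * norm (x 0)"
    using trajectory_norm_le by metis
  have "norm (x n t) \<le> R * norm y" if "t \<ge> 0" for n t
    using R[OF x(1) that, of n] x(2)[of n] by simp
  from trajectories_pointwise_compact[where x = x, OF compact convex x(1) this]
  obtain r z where r: "strict_mono r" and z: "trajectory M z"
    and lim: "\<And>t. t \<ge> 0 \<Longrightarrow> (\<lambda>k. x (r k) t) \<longlonglongrightarrow> z t"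
    by blast
  have z0: "z 0 = y" using LIMSEQ_unique[OF lim[of 0]] x(2) by simp
  have "v (z t) = v y" if t: "t \<ge> 0" for t
  proof (rule antisym)
    show "v (z t) \<le> v y" using v_decreasing[OF z t] z0 by simp
    have a: "(\<lambda>k. v (x (r k) t)) \<longlonglongrightarrow> v (z t)"
      using continuous_on_tendsto_compose[OF is_norm_continuous[OF is_norm_v] lim[OF t]] by simp
    have "(\<lambda>k. v y - 1 / real (Suc k)) \<longlonglongrightarrow> v y - 0"
      by (intro tendsto_diff tendsto_const LIMSEQ_Suc[OF lim_1_over_n])
    from LIMSEQ_subseq_LIMSEQ[OF this r]
    have b: "(\<lambda>k. v y - 1 / real (Suc (r k))) \<longlonglongrightarrow> v y" by (simp add: o_def)
    obtain N :: nat where N: "t \<le> real N" using real_arch_simple by blast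
    \<comment> \<open>Since \<open>v\<close> does not increase along trajectories, near-optimality
      at the later time \<open>r k\<close> implies it at \<open>t\<close>; so growing horizons
      eventually cover every fixed time.\<close>
    have "v y - 1 / real (Suc (r k)) \<le> v (x (r k) t)" if "k \<ge> N" for k
    proof -
      have "t \<le> real (r k)" using N that seq_suble[OF r, of k] by linarith
      then show ?thesis using x(3)[of "r k"] v_antimono[OF x(1) t] by (meson less_imp_le order_trans)
    qed
    then show "v y \<le> v (z t)" by (intro LIMSEQ_le[OF b a]) blast
  qed
  with z z0 show thesis by (rule that)
qed

text \<open>The witness is a pointwise limit of time shifts of \<open>x\<close>.\<close>

lemma omega_limit_trajectory:
  assumes x: "trajectory M x"
  obtains z where "trajectory M z" "\<And>t. t \<ge> 0 \<Longrightarrow> z t \<in> omega_limit x"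
proof -
  have sh: "trajectory M (\<lambda>t. x (real k + t))" for k :: nat
    by (rule trajectory_shift[OF compact convex x]) simp
  obtain R where R: "\<And>x t. trajectory M x \<Longrightarrow> 0 \<le> t \<Longrightarrow> norm (x t) \<le> R * norm (x 0)"
    using trajectory_norm_le by metis
  have "norm (x (real k + t)) \<le> R * norm (x 0)" if "t \<ge> 0" for k t
    using R[OF x, of "real k + t"] that by simp
  from trajectories_pointwise_compact[where x = "\<lambda>k t. x (real k + t)", OF compact convex sh this]
  obtain r z where r: "strict_mono r" and z: "trajectory M z"
    and lim: "\<And>t. t \<ge> 0 \<Longrightarrow> (\<lambda>k. x (real (r k) + t)) \<longlonglongrightarrow> z t"
    by blast
  have "z t \<in> omega_limit x" if t: "t \<ge> 0" for t
  proof -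
    have "filterlim (\<lambda>k. real (r k)) at_top sequentially"
      using r by (intro filterlim_compose[OF filterlim_real_sequentially] filterlim_subseq)
    then have "filterlim (\<lambda>k. real (r k) + t) at_top sequentially"
      using t by (auto intro: filterlim_at_top_mono)
    with lim[OF t] show ?thesis
      unfolding omega_limit_def by (intro CollectI exI[of _ "\<lambda>k. real (r k) + t"] conjI)
  qed
  with z show thesis by (rule that)
qed

section \<open>Uniqueness up to a positive factor\<close>

lemma constant_along_chain:
  fixes N :: nat
  assumes "N > 0" and x: "\<And>i. i \<in> {1..N} \<Longrightarrow> trajectory M (x i)"
    and z1: "z1 \<in> omega_limit (x 1)" and z2: "z2 \<in> omega_limit (x N)"
    and link: "\<And>i. i \<in> {1..N - 1} \<Longrightarrow> omega_limit (x i) \<inter> omega_limit (x (i + 1)) \<noteq> {}"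
  shows "w z2 = w z1"
proof -
  \<comment> \<open>Induction along the chain: a common point of consecutive limit sets hands the
    value of \<open>w\<close> on to the next one.\<close>
  have "\<forall>z\<in>omega_limit (x i). w z = w z1" if "1 \<le> i" "i \<le> N" for i
    using that
  proof (induction i rule: nat_induct_at_least)
    case base
    then show ?case using omega_limit_const[OF x[of 1] _ z1] by auto
  next
    case (Suc i)
    have "i \<in> {1..N - 1}" using Suc.hyps Suc.prems by auto
    then obtain p where p: "p \<in> omega_limit (x i)" "p \<in> omega_limit (x (Suc i))"
      using link[of i] by auto
    have "w p = w z1" using Suc p(1) by simp
    then show ?case using omega_limit_const[OF x[of "Suc i"] _ p(2)] Suc \<open>w p = w z1\<close> by auto
  qed
  from this[of N] show ?thesis using \<open>N > 0\<close> z2 by simp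
qed

theorem unique_if_constant:
  assumes c: "\<And>z. z \<in> extremal_limit_set M v \<Longrightarrow> w z = c"
  shows "w y = c * v y"
proof (cases "y = 0")
  case True
  then show ?thesis by (simp add: is_norm_zero[OF is_norm] is_norm_zero[OF is_norm_v])
next
  case y: False
  obtain R where R: "\<And>x t. trajectory M x \<Longrightarrow> 0 \<le> t \<Longrightarrow> norm (x t) \<le> R * norm (x 0)"
    using trajectory_norm_le by metis
  \<comment> \<open>A trajectory on the level \<open>v = r\<close> is scaled into the unit sphere of
    \<open>v\<close>, where the hypothesis on \<open>c\<close> applies to its limit points; scaling
    back multiplies the value by \<open>r\<close>.\<close>
  have normalise: "\<exists>z. z \<in> omega_limit x \<and> w z = c * r"
    if x: "trajectory M x" "\<And>t. t \<ge> 0 \<Longrightarrow> v (x t) = r" "r > 0" for x r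
  proof -
    define \<xi> where "\<xi> t = (1 / r) *\<^sub>R x t" for t
    have \<xi>: "trajectory M \<xi>" unfolding \<xi>_def by (rule trajectory_scaleR[OF compact convex x(1)])
    have v1: "v (\<xi> t) = 1" if "t \<ge> 0" for t using x(2)[OF that] x(3) by (simp add: \<xi>_def v_scaleR)
    obtain z where z: "z \<in> omega_limit \<xi>" using omega_limit_nonempty R[OF \<xi>] by metis
    have "z \<in> extremal_limit_set M v"
      unfolding extremal_limit_set_def extremal_def using \<xi> v1 z by auto
    then have "w z = c" by (rule c)
    then have "w (r *\<^sub>R z) = c * r" using x(3) by (simp add: is_norm_scaleR[OF is_norm])
    moreover have "r *\<^sub>R z \<in> omega_limit x"
    proof -
      obtain s where s: "filterlim s at_top sequentially" "(\<lambda>k. \<xi> (s k)) \<longlonglongrightarrow> z"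
        using z by (auto simp: omega_limit_def)
      have "(\<lambda>k. r *\<^sub>R \<xi> (s k)) \<longlonglongrightarrow> r *\<^sub>R z" by (intro tendsto_intros s(2))
      with s(1) x(3) show ?thesis by (auto simp: omega_limit_def \<xi>_def)
    qed
    ultimately show ?thesis by blast
  qed
  show ?thesis
  proof (rule antisym)
    obtain x where x: "trajectory M x" "x 0 = y" "\<And>t. t \<ge> 0 \<Longrightarrow> v (x t) = v y"
      using v_extremal_exists[where y = y] by blast
    obtain z where z: "z \<in> omega_limit x" "w z = c * v y"
      using normalise[OF x(1,3) v_pos[OF y]] by blast
    then show "c * v y \<le> w y"
      using omega_limit_upper[OF x(1) z(1)] x(2) by simp
    \<comment> \<open>The hypothesis says nothing about the sign of \<open>c\<close>. It is read off
      the nonzero limit point \<open>z\<close> and is used below to multiply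
      \<open>v (z 0) \<le> v y\<close> by \<open>c\<close>.\<close>
    have "v z = v y"
      by (rule omega_limit_eq[OF is_norm_continuous[OF is_norm_v] x(3) z(1)])
    then have "z \<noteq> 0" using v_pos[OF y] is_norm_zero[OF is_norm_v] by auto
    then have "c * v y > 0" using is_norm_pos[OF is_norm, of z] z(2) by simp
    then have "c > 0" using v_pos[OF y] by (simp add: zero_less_mult_iff)
    \<comment> \<open>This \<open>x\<close> is known to be extremal for \<open>w\<close> only.
      Passing to \<open>z\<close> inside its limit set makes \<open>v\<close> constant as well; the
      value \<open>v (z 0)\<close> may be smaller than \<open>v y\<close>, which is the harmless
      direction here.\<close>
    obtain x where x: "trajectory M x" "x 0 = y" "\<And>t. t \<ge> 0 \<Longrightarrow> w (x t) = w y"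
      using extremal_exists by blast
    obtain z where z: "trajectory M z" "\<And>t. t \<ge> 0 \<Longrightarrow> z t \<in> omega_limit x"
      using omega_limit_trajectory[OF x(1)] by blast
    have wz: "w (z t) = w y" if "t \<ge> 0" for t
      by (rule omega_limit_eq[OF is_norm_continuous[OF is_norm] x(3) z(2)[OF that]])
    have vz: "v (z t) = v (z 0)" if "t \<ge> 0" for t
      by (rule v_omega_limit_const[OF x(1) z(2)[OF that] z(2)]) simp
    have "z 0 \<noteq> 0" using wz[of 0] is_norm_pos[OF is_norm y] is_norm_zero[OF is_norm] by auto
    then obtain p where p: "p \<in> omega_limit z" "w p = c * v (z 0)"
      using normalise[OF z(1) vz v_pos] by blast
    have "w p = w y" by (rule omega_limit_eq[OF is_norm_continuous[OF is_norm] wz p(1)])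
    moreover have "v (z 0) \<le> v y"
      using v_omega_limit_upper[OF x(1) z(2)[of 0]] x(2) by simp
    then have "c * v (z 0) \<le> c * v y" using \<open>c > 0\<close> by (intro mult_left_mono) auto
    ultimately show "w y \<le> c * v y" using p(2) by simp
  qed
qed

end

theorem theorem4:
  fixes M :: "(real ^ 'n ^ 'n) set"
    and v :: "real ^ 'n \<Rightarrow> real"
    and \<Omega> :: "(real ^ 'n) set"
  assumes "compact M" and "convex M" and "irreducible_matrices M"
    and "lyapunov_exponent M = 0"
  defines "v \<equiv> limsup_norm M"
  defines "\<Omega> \<equiv> extremal_limit_set M v"
  assumes "\<exists>\<Omega>'. \<Omega>' \<subseteq> \<Omega> \<and> \<Omega> \<subseteq> closure \<Omega>' \<and>
      (\<forall>z1\<in>\<Omega>'. \<forall>z2\<in>\<Omega>'. \<exists>(N::nat) (x :: nat \<Rightarrow> real \<Rightarrow> real ^ 'n). N > 0 \<and>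
         (\<forall>i\<in>{1..N}. extremal M v (x i)) \<and>
         z1 \<in> omega_limit (x 1) \<and> z2 \<in> omega_limit (x N) \<and>
         (\<forall>i\<in>{1..N - 1}. omega_limit (x i) \<inter> omega_limit (x (i + 1)) \<noteq> {}))"
  shows "\<forall>w. barabanov_norm M w \<longrightarrow> (\<exists>c>0. \<forall>y. w y = c * v y)"
proof (intro allI impI)
  fix w :: "real ^ 'n \<Rightarrow> real"
  assume w: "barabanov_norm M w"
  have sys: "barabanov_system M w"
    using assms(1,2) w by (rule barabanov_system.intro)
  have norm_w: "is_norm w" using w by (simp add: barabanov_norm_def)
  obtain \<Omega>' where dense: "\<Omega> \<subseteq> closure \<Omega>'"
    and chain: "\<And>z1 z2. z1 \<in> \<Omega>' \<Longrightarrow> z2 \<in> \<Omega>' \<Longrightarrow>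
      \<exists>(N::nat) (x :: nat \<Rightarrow> real \<Rightarrow> real ^ 'n). N > 0 \<and> (\<forall>i\<in>{1..N}. extremal M v (x i)) \<and>
        z1 \<in> omega_limit (x 1) \<and> z2 \<in> omega_limit (x N) \<and>
        (\<forall>i\<in>{1..N - 1}. omega_limit (x i) \<inter> omega_limit (x (i + 1)) \<noteq> {})"
    using assms(7) by blast
  have const: "w z2 = w z1" if z: "z1 \<in> \<Omega>'" "z2 \<in> \<Omega>'" for z1 z2
  proof -
    obtain N :: nat and x :: "nat \<Rightarrow> real \<Rightarrow> real ^ 'n" where N: "N > 0"
      and x: "\<forall>i\<in>{1..N}. extremal M v (x i)" "z1 \<in> omega_limit (x 1)" "z2 \<in> omega_limit (x N)"
        "\<forall>i\<in>{1..N - 1}. omega_limit (x i) \<inter> omega_limit (x (i + 1)) \<noteq> {}"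
      using chain[OF z] by blast
    show ?thesis
      by (rule barabanov_system.constant_along_chain[OF sys N _ x(2,3)])
        (use x(1,4) in \<open>auto simp: extremal_def\<close>)
  qed
  \<comment> \<open>For an empty \<open>\<Omega>'\<close> any number would do; otherwise
    \<open>c\<close> is the value of \<open>w\<close> at one of its points.\<close>
  obtain c where c: "\<And>z. z \<in> \<Omega>' \<Longrightarrow> w z = c"
    using const by (cases "\<Omega>' = {}") blast+
  have "w z = c" if "z \<in> \<Omega>" for z
    by (rule continuous_constant_on_closure[OF continuous_on_subset[OF is_norm_continuous[OF norm_w]] c])
      (use that dense in auto)
  then have eq: "w y = c * v y" for y
    unfolding v_def \<Omega>_def by (intro barabanov_system.unique_if_constant[OF sys])
  \<comment> \<open>One nonzero vector suffices: \<open>w y\<close> and \<open>v y\<close> are both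
    positive, and their ratio is \<open>c\<close>.\<close>
  obtain y :: "real ^ 'n" where "y \<noteq> 0" using nonzero_Basis nonempty_Basis by blast
  then have "0 < w y" "0 < v y"
    using is_norm_pos[OF norm_w] barabanov_system.v_pos[OF sys] by (auto simp: v_def)
  then have "c > 0" by (simp add: eq zero_less_mult_iff)
  with eq show "\<exists>c>0. \<forall>y. w y = c * v y" by blast
qed

end
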